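(* Let $M$ be a von Neumann algebra and let $a,b\in M$ with $0\le a,b\le 1$. Then $a$ and $b$ are absolutely compatible if, and only if, there exists $b_2\in M$ with $0\le b_2\le 1$ such that, setting $n_1(b_2):=1-s(a)-n(a)-s(b_2)-r(e(b_2))$, the elements $s(a),\ s(b_2),\ r(e(b_2)),\ n_1(b_2),\ n(a)$ form a set of mutually orthogonal projections with $$s(a)+s(b_2)+r(e(b_2))+n_1(b_2)+n(a)=1,$$ and there exist $b_1,a_1,a_2,a_3,b_3\in M$ with $0\le b_1\le s(a)$, $0\le a_1\le s(b_2)$, $0\le a_2\le r(e(b_2))$, $0\le e(b_2)\le r(e(b_2))$, $0\le a_3\le n_1(b_2)$ and $0\le b_3\le n(a)$, such that $a_2$ is absolutely compatible with $e(b_2)$, $$a=s(a)+a_1+a_2+a_3\quad\text{and}\quad b=b_1+s(b_2)+e(b_2)+b_3.$$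
   Context: For $x$ in a C$^*$-algebra, $|x|=(x^*x)^{1/2}$. Elements $0\le a,b\le 1$ of a unital C$^*$-algebra are absolutely compatible if $|a-b|+|1-a-b|=1$. For a positive element $x$ of a von Neumann algebra $M$, $r(x)$ denotes its range projection. For $0\le c\le 1$ in $M$: $s(c)=1-r(1-c)$ (support projection, the largest projection $p$ with $pc=p$), $e(c)=c-s(c)$ (almost strict part), and $n(c)=1-r(c)$. In the paper, $n_1(b_2)$ is defined as $r(e(a))-s(b_2)-r(e(b_2))$, which equals the expression above since $r(e(a))=1-s(a)-n(a)$. *)

theory Defs
  imports "HOL-Analysis.Analysis"
begin

class complex_vector = real_vector +
  fixes scaleC :: "complex \<Rightarrow> 'a \<Rightarrow> 'a" (infixr \<open>*\<^sub>C\<close> 75)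
  assumes scaleC_add_right: "c *\<^sub>C (x + y) = c *\<^sub>C x + c *\<^sub>C y"
    and scaleC_add_left: "(c + d) *\<^sub>C x = c *\<^sub>C x + d *\<^sub>C x"
    and scaleC_scaleC: "c *\<^sub>C (d *\<^sub>C x) = (c * d) *\<^sub>C x"
    and scaleC_one: "1 *\<^sub>C x = x"
    and scaleR_scaleC: "scaleR r x = complex_of_real r *\<^sub>C x"

class complex_inner = complex_vector + real_normed_vector +
  fixes cinner :: "'a \<Rightarrow> 'a \<Rightarrow> complex"
  assumes cinner_commute: "cinner x y = cnj (cinner y x)"
    and cinner_add_right: "cinner x (y + z) = cinner x y + cinner x z"
    and cinner_scaleC_right: "cinner x (c *\<^sub>C y) = c * cinner x y"
    and cinner_ge_zero: "Im (cinner x x) = 0 \<and> Re (cinner x x) \<ge> 0"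
    and cinner_eq_zero_iff: "cinner x x = 0 \<longleftrightarrow> x = 0"
    and norm_eq_sqrt_cinner: "norm x = sqrt (Re (cinner x x))"

class chilbert_space = complex_inner + complete_space

definition bounded_op :: "('h::chilbert_space \<Rightarrow> 'h) \<Rightarrow> bool" where
  "bounded_op f \<longleftrightarrow> (\<forall>x y. f (x + y) = f x + f y) \<and> (\<forall>c x. f (c *\<^sub>C x) = c *\<^sub>C f x)
      \<and> (\<exists>K. \<forall>x. norm (f x) \<le> norm x * K)"

definition op_add :: "('h::chilbert_space \<Rightarrow> 'h) \<Rightarrow> ('h \<Rightarrow> 'h) \<Rightarrow> 'h \<Rightarrow> 'h" where
  "op_add f g = (\<lambda>x. f x + g x)"

definition op_sub :: "('h::chilbert_space \<Rightarrow> 'h) \<Rightarrow> ('h \<Rightarrow> 'h) \<Rightarrow> 'h \<Rightarrow> 'h" where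
  "op_sub f g = (\<lambda>x. f x - g x)"

definition op_zero :: "'h::chilbert_space \<Rightarrow> 'h" where
  "op_zero = (\<lambda>x. 0)"

text \<open>The unit of B(H) is the identity operator id; the product is composition.\<close>

definition adj :: "('h::chilbert_space \<Rightarrow> 'h) \<Rightarrow> 'h \<Rightarrow> 'h" where
  "adj f = (THE g. \<forall>x y. cinner (f x) y = cinner x (g y))"

definition op_pos :: "('h::chilbert_space \<Rightarrow> 'h) \<Rightarrow> bool" where
  "op_pos x \<longleftrightarrow> bounded_op x \<and> (\<forall>\<xi>. Im (cinner (x \<xi>) \<xi>) = 0 \<and> Re (cinner (x \<xi>) \<xi>) \<ge> 0)"

definition op_le :: "('h::chilbert_space \<Rightarrow> 'h) \<Rightarrow> ('h \<Rightarrow> 'h) \<Rightarrow> bool" where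
  "op_le a b \<longleftrightarrow> bounded_op a \<and> bounded_op b \<and> op_pos (op_sub b a)"

definition op_sqrt :: "('h::chilbert_space \<Rightarrow> 'h) \<Rightarrow> 'h \<Rightarrow> 'h" where
  "op_sqrt x = (THE y. op_pos y \<and> y \<circ> y = x)"

definition op_abs :: "('h::chilbert_space \<Rightarrow> 'h) \<Rightarrow> 'h \<Rightarrow> 'h" where
  "op_abs x = op_sqrt (adj x \<circ> x)"

definition is_projection :: "('h::chilbert_space \<Rightarrow> 'h) \<Rightarrow> bool" where
  "is_projection p \<longleftrightarrow> bounded_op p \<and> p \<circ> p = p \<and> adj p = p"

definition range_proj :: "('h::chilbert_space \<Rightarrow> 'h) \<Rightarrow> 'h \<Rightarrow> 'h" where
  "range_proj x = (THE p. is_projection p \<and> range p = closure (range x))"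

definition supp_proj :: "('h::chilbert_space \<Rightarrow> 'h) \<Rightarrow> 'h \<Rightarrow> 'h" where
  "supp_proj c = op_sub id (range_proj (op_sub id c))"

definition ast_part :: "('h::chilbert_space \<Rightarrow> 'h) \<Rightarrow> 'h \<Rightarrow> 'h" where
  "ast_part c = op_sub c (supp_proj c)"

definition null_proj :: "('h::chilbert_space \<Rightarrow> 'h) \<Rightarrow> 'h \<Rightarrow> 'h" where
  "null_proj c = op_sub id (range_proj c)"

definition abs_compatible :: "('h::chilbert_space \<Rightarrow> 'h) \<Rightarrow> ('h \<Rightarrow> 'h) \<Rightarrow> bool" where
  "abs_compatible a b \<longleftrightarrow>
     op_add (op_abs (op_sub a b)) (op_abs (op_sub (op_sub id a) b)) = id"

definition commutant :: "('h::chilbert_space \<Rightarrow> 'h) set \<Rightarrow> ('h \<Rightarrow> 'h) set" where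
  "commutant S = {y. bounded_op y \<and> (\<forall>x\<in>S. x \<circ> y = y \<circ> x)}"

text \<open>A von Neumann algebra: a self-adjoint set of bounded operators equal to its bicommutant
  (equivalently, a unital *-subalgebra of B(H) closed in the weak operator topology).\<close>
definition von_neumann_algebra :: "('h::chilbert_space \<Rightarrow> 'h) set \<Rightarrow> bool" where
  "von_neumann_algebra M \<longleftrightarrow> (\<forall>x\<in>M. bounded_op x) \<and> (\<forall>x\<in>M. adj x \<in> M)
     \<and> commutant (commutant M) = M"

definition mutually_orthogonal_projections :: "('h::chilbert_space \<Rightarrow> 'h) list \<Rightarrow> bool" where
  "mutually_orthogonal_projections ps \<longleftrightarrow>
     (\<forall>i<length ps. is_projection (ps ! i)) \<and>
     (\<forall>i<length ps. \<forall>j<length ps. i \<noteq> j \<longrightarrow> (ps ! i) \<circ> (ps ! j) = op_zero)"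

end

(*
  Both directions rest on one reformulation: a and b are absolutely compatible iff
  x = a + b - ab - ba satisfies 0 <= x <= 1 and x^2 = (a - b)^2, for then |a - b| = x and
  |1 - a - b| = 1 - x.  If a xi = xi, then x xi = a(1 - b) xi and (a - b) xi = (1 - b) xi have the
  same norm; as a is a positive contraction, it must fix (1 - b) xi, hence also b xi.  So b leaves
  ker(1 - a) invariant, and by symmetry (replace a by 1 - a, swap a and b) b commutes with s(a) and
  n(a), and a commutes with the corresponding projections of b_2 = (1 - s(a) - n(a)) b.  Cutting a
  and b by these projections gives the decomposition.  Conversely the reformulated condition may be
  checked on each of the five blocks separately, and it is trivial as soon as one of the two
  elements is a projection commuting with the other.
*)

theory Submission
  imports Defs "HOL-Computational_Algebra.Formal_Power_Series"
begin

section \<open>Complex inner products\<close>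

text \<open>The polynomial x comes from comparing squares: if u and 1 - u are the two absolute
  values, then (1 - u)^2 - u^2 = (1 - a - b)^2 - (a - b)^2 is linear in u and has the solution u = a
  + b - ab - ba. From then on no absolute value has to be localised: an equation between squares and
  two positivity statements pass to and from the corners cut out by commuting projections. Two
  obstacles shape the rest. Adjoints, square roots and range projections are definite descriptions,
  so existence and uniqueness come before any computation with them; the only piece of functional
  calculus is the square root, built from a power series. And commutation of a with r(e(b_2)) is
  reached only through r(e(b_2)) = 1 - s(b_2) - n(b_2), where the kernel of b_2 is in general larger
  than that of b and has to be traced back to it through the compression by 1 - s(a) - n(a).\<close>

lemma cinner_add_left: "cinner (x + y) z = cinner x z + cinner (y :: 'h::complex_inner) z"
  by (metis cinner_add_right cinner_commute complex_cnj_add)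

lemma cinner_scaleC_left: "cinner (c *\<^sub>C x) y = cnj c * cinner x (y :: 'h::complex_inner)"
  by (metis cinner_scaleC_right cinner_commute complex_cnj_mult)

lemma cinner_scaleR_right: "cinner x (r *\<^sub>R y) = complex_of_real r * cinner x (y :: 'h::complex_inner)"
  by (simp add: scaleR_scaleC cinner_scaleC_right)

lemma cinner_scaleR_left: "cinner (r *\<^sub>R x) y = complex_of_real r * cinner x (y :: 'h::complex_inner)"
  by (simp add: scaleR_scaleC cinner_scaleC_left)

lemma cinner_zero_right [simp]: "cinner x (0 :: 'h::complex_inner) = 0"
  using cinner_add_right[of x 0 0] by simp

lemma cinner_zero_left [simp]: "cinner (0 :: 'h::complex_inner) x = 0"
  using cinner_add_left[of 0 0 x] by simp

lemma cinner_minus_right: "cinner x (- y) = - cinner x (y :: 'h::complex_inner)"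
  using cinner_scaleR_right[of x "- 1" y] by simp

lemma cinner_minus_left: "cinner (- x) y = - cinner x (y :: 'h::complex_inner)"
  using cinner_scaleR_left[of "- 1" x y] by simp

lemma cinner_diff_right: "cinner x (y - z) = cinner x y - cinner x (z :: 'h::complex_inner)"
  using cinner_add_right[of x y "- z"] by (simp add: cinner_minus_right)

lemma cinner_diff_left: "cinner (x - y) z = cinner x z - cinner y (z :: 'h::complex_inner)"
  using cinner_add_left[of x "- y" z] by (simp add: cinner_minus_left)

lemmas cinner_simps = cinner_add_left cinner_add_right cinner_diff_left cinner_diff_right
  cinner_minus_left cinner_minus_right cinner_scaleR_left cinner_scaleR_right

lemma Re_cinner_commute: "Re (cinner x y) = Re (cinner y (x :: 'h::complex_inner))"
  by (subst cinner_commute) simp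

lemma norm_sq_cinner: "(norm (x :: 'h::complex_inner))\<^sup>2 = Re (cinner x x)"
  using cinner_ge_zero[of x] by (simp add: norm_eq_sqrt_cinner)

lemma cinner_self: "cinner x x = complex_of_real ((norm (x :: 'h::complex_inner))\<^sup>2)"
  using cinner_ge_zero[of x] by (simp add: norm_sq_cinner complex_eq_iff)

lemma Im_cinner: "Im (cinner x y) = - Re (cinner x (\<i> *\<^sub>C (y :: 'h::complex_inner)))"
  by (simp add: cinner_scaleC_right)

lemma cinner_eqI: "(\<And>x. cinner x y = cinner x z) \<Longrightarrow> y = (z :: 'h::complex_inner)"
  using cinner_eq_zero_iff[of "y - z"] by (simp add: cinner_diff_right)

text \<open>For c > 0 the quadratic is smallest at t = - b / c, and its value there gives the
  inequality. The case c = 0 is included because the form of a positive operator may vanish on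
  nonzero vectors.\<close>

lemma quadratic_nonneg_discriminant:
  fixes a b c :: real
  assumes "\<And>t. a + 2 * t * b + t\<^sup>2 * c \<ge> 0" and "c \<ge> 0"
  shows "b\<^sup>2 \<le> a * c"
proof (cases "c = 0")
  case True
  have "b = 0"
  proof (rule ccontr)
    assume "b \<noteq> 0"
    \<comment> \<open>At t = - (a + 1) / (2 b) the affine function a + 2 t b takes the value
      -1.\<close>
    then have "2 * (- (a + 1) / (2 * b)) * b = - (a + 1)" by simp
    then show False using assms(1)[of "- (a + 1) / (2 * b)"] True by simp
  qed
  then show ?thesis using True by simp
next
  case False
  then have c: "c > 0" using assms(2) by simp
  have "0 \<le> a + 2 * (- b / c) * b + (- b / c)\<^sup>2 * c" by (rule assms(1))
  also have "\<dots> = a - b\<^sup>2 / c" using c by (simp add: power2_eq_square field_simps)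
  finally show ?thesis using c by (simp add: field_simps)
qed

lemma abs_Re_cinner_le: "\<bar>Re (cinner x y)\<bar> \<le> norm x * norm (y :: 'h::complex_inner)"
proof -
  have "(Re (cinner x y))\<^sup>2 \<le> (norm x)\<^sup>2 * (norm y)\<^sup>2"
  proof (rule quadratic_nonneg_discriminant)
    fix t :: real
    have "0 \<le> Re (cinner (x + t *\<^sub>R y) (x + t *\<^sub>R y))" using cinner_ge_zero by blast
    also have "\<dots> = (norm x)\<^sup>2 + 2 * t * Re (cinner x y) + t\<^sup>2 * (norm y)\<^sup>2"
      unfolding norm_sq_cinner
      by (simp add: cinner_simps Re_cinner_commute[of y x] algebra_simps power2_eq_square)
    finally show "0 \<le> \<dots>" .
  qed simp
  then show ?thesis
    by (metis abs_le_square_iff abs_mult abs_norm_cancel power_mult_distrib)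
qed

lemma norm_scaleC: "norm (c *\<^sub>C x) = cmod c * norm (x :: 'h::complex_inner)"
proof (rule power2_eq_imp_eq)
  have "cinner (c *\<^sub>C x) (c *\<^sub>C x) = (c * cnj c) * cinner x x"
    by (simp add: cinner_scaleC_left cinner_scaleC_right)
  also have "\<dots> = complex_of_real ((cmod c)\<^sup>2 * (norm x)\<^sup>2)"
    using complex_norm_square[of c] by (simp add: cinner_self)
  finally have "cinner (c *\<^sub>C x) (c *\<^sub>C x) = complex_of_real ((cmod c)\<^sup>2 * (norm x)\<^sup>2)" .
  then show "(norm (c *\<^sub>C x))\<^sup>2 = (cmod c * norm x)\<^sup>2"
    unfolding norm_sq_cinner[of "c *\<^sub>C x"] by (simp add: power_mult_distrib)
qed auto

text \<open>Only continuity is wanted, so real and imaginary parts are estimated separately; this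
  accounts for the constant 2.\<close>

lemma bounded_bilinear_cinner: "bounded_bilinear (cinner :: 'h::complex_inner \<Rightarrow> 'h \<Rightarrow> complex)"
proof
  show "\<exists>K. \<forall>x y :: 'h. norm (cinner x y) \<le> norm x * norm y * K"
  proof (intro exI allI)
    fix x y :: 'h
    have "cmod (cinner x y) \<le> \<bar>Re (cinner x y)\<bar> + \<bar>Im (cinner x y)\<bar>" by (rule cmod_le)
    also have "\<dots> \<le> norm x * norm y + norm x * norm y"
      using abs_Re_cinner_le[of x y] abs_Re_cinner_le[of x "\<i> *\<^sub>C y"]
      by (simp add: Im_cinner norm_scaleC)
    finally show "norm (cinner x y) \<le> norm x * norm y * 2" by simp
  qed
qed (simp_all add: cinner_simps scaleR_conv_of_real)

lemma parallelogram:
  "(norm (x + y))\<^sup>2 + (norm (x - y))\<^sup>2 = 2 * (norm x)\<^sup>2 + 2 * (norm (y :: 'h::complex_inner))\<^sup>2"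
  by (simp add: norm_sq_cinner cinner_simps)

lemma norm_diff_scaleR_sq:
  "(norm (x - t *\<^sub>R y))\<^sup>2 = (norm x)\<^sup>2 - 2 * t * Re (cinner y x) + t\<^sup>2 * (norm (y :: 'h::complex_inner))\<^sup>2"
  unfolding norm_sq_cinner
  by (simp add: cinner_simps Re_cinner_commute[of x y] algebra_simps power2_eq_square)

lemma norm_add_sq:
  "(norm (x + y))\<^sup>2 = (norm x)\<^sup>2 + (norm y)\<^sup>2 + 2 * Re (cinner x (y :: 'h::complex_inner))"
  using norm_diff_scaleR_sq[of x "- 1" y] by (simp add: Re_cinner_commute[of y x])

section \<open>Orthogonal projections and adjoints\<close>

definition csubspace :: "'h::complex_vector set \<Rightarrow> bool" where
  "csubspace S \<longleftrightarrow> 0 \<in> S \<and> (\<forall>x\<in>S. \<forall>y\<in>S. x + y \<in> S) \<and> (\<forall>c. \<forall>x\<in>S. c *\<^sub>C x \<in> S)"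

lemma csubspaceD:
  assumes "csubspace S"
  shows "0 \<in> S" "x \<in> S \<Longrightarrow> y \<in> S \<Longrightarrow> x + y \<in> S" "x \<in> S \<Longrightarrow> c *\<^sub>C x \<in> S"
    "x \<in> S \<Longrightarrow> r *\<^sub>R x \<in> S" "x \<in> S \<Longrightarrow> y \<in> S \<Longrightarrow> x - y \<in> S"
proof -
  show add: "x \<in> S \<Longrightarrow> y \<in> S \<Longrightarrow> x + y \<in> S" for x y using assms by (simp add: csubspace_def)
  show "x \<in> S \<Longrightarrow> c *\<^sub>C x \<in> S" for c x using assms by (simp add: csubspace_def)
  show scale: "x \<in> S \<Longrightarrow> r *\<^sub>R x \<in> S" for r x using assms by (simp add: csubspace_def scaleR_scaleC)
  show "x \<in> S \<Longrightarrow> y \<in> S \<Longrightarrow> x - y \<in> S" using add[of x "- y"] scale[of y "-1"] by simp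
qed (use assms in \<open>simp add: csubspace_def\<close>)

text \<open>By the parallelogram law a minimising sequence for the distance from x to S is Cauchy;
  its limit is a nearest point, and orthogonality is the first-order condition there.\<close>

lemma orthogonal_projection_exists:
  fixes S :: "'h::chilbert_space set"
  assumes S: "csubspace S" and "closed S"
  shows "\<exists>y\<in>S. \<forall>z\<in>S. cinner z (x - y) = 0"
proof -
  note sub = csubspaceD[OF S]
  have ne: "S \<noteq> {}" using sub(1) by blast
  define d where "d = infdist x S"
  have d0: "d \<ge> 0" unfolding d_def by (rule infdist_nonneg)
  have d_le: "d \<le> norm (x - y)" if "y \<in> S" for y
    unfolding d_def using infdist_le[OF that, of x] by (simp add: dist_norm)
  have "\<exists>y\<in>S. norm (x - y) < d + inverse (real (Suc n))" for n
  proof -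
    have "(INF y\<in>S. dist x y) < d + inverse (real (Suc n))"
      using ne by (simp add: d_def infdist_notempty)
    moreover have "bdd_below (dist x ` S)" by (auto intro: bdd_belowI[of _ 0])
    ultimately show ?thesis using cINF_less_iff[OF ne, of "dist x"] by (simp add: dist_norm)
  qed
  then obtain Y where Y: "\<And>n. Y n \<in> S" and Yd: "\<And>n. norm (x - Y n) < d + inverse (real (Suc n))"
    by metis
  have dist_Y: "(norm (Y m - Y n))\<^sup>2 \<le> 2 * (d + inverse (real (Suc m)))\<^sup>2 + 2 * (d + inverse (real (Suc n)))\<^sup>2 - 4 * d\<^sup>2" for m n
  proof -
    \<comment> \<open>The midpoint of two members of the sequence lies in S, hence is at distance at
      least d from x; the parallelogram law turns this into a bound on their distance.\<close>
    have "(1/2) *\<^sub>R (Y m + Y n) \<in> S" by (intro sub(2,4) Y)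
    from d_le[OF this] have "2 * d \<le> norm (2 *\<^sub>R (x - (1/2) *\<^sub>R (Y m + Y n)))" by simp
    also have "2 *\<^sub>R (x - (1/2) *\<^sub>R (Y m + Y n)) = (x - Y m) + (x - Y n)"
      by (simp add: algebra_simps scaleR_2)
    finally have "(2 * d)\<^sup>2 \<le> (norm ((x - Y m) + (x - Y n)))\<^sup>2"
      using d0 by (intro power_mono) auto
    moreover have "(norm (x - Y k))\<^sup>2 \<le> (d + inverse (real (Suc k)))\<^sup>2" for k
      using Yd[of k] by (intro power_mono) auto
    from this[of m] this[of n]
    have "2 * (norm (x - Y m))\<^sup>2 + 2 * (norm (x - Y n))\<^sup>2
        \<le> 2 * (d + inverse (real (Suc m)))\<^sup>2 + 2 * (d + inverse (real (Suc n)))\<^sup>2" by linarith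
    ultimately show ?thesis
      using parallelogram[of "x - Y m" "x - Y n"] by (simp add: norm_minus_commute power_mult_distrib)
  qed
  have lim: "(\<lambda>k. 4 * (d + inverse (real (Suc k)))\<^sup>2 - 4 * d\<^sup>2) \<longlonglongrightarrow> 4 * (d + 0)\<^sup>2 - 4 * d\<^sup>2"
    by (intro tendsto_intros LIMSEQ_inverse_real_of_nat)
  have "Cauchy Y"
  proof (rule CauchyI)
    fix e :: real assume e: "e > 0"
    have "\<forall>\<^sub>F k in sequentially. 4 * (d + inverse (real (Suc k)))\<^sup>2 - 4 * d\<^sup>2 < e\<^sup>2"
      using lim e by (intro order_tendstoD(2)[OF lim]) simp
    then obtain N where N: "4 * (d + inverse (real (Suc N)))\<^sup>2 - 4 * d\<^sup>2 < e\<^sup>2"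
      unfolding eventually_sequentially by blast
    show "\<exists>M. \<forall>m\<ge>M. \<forall>n\<ge>M. norm (Y m - Y n) < e"
    proof (intro exI allI impI)
      fix m n assume mn: "N \<le> m" "N \<le> n"
      have "(d + inverse (real (Suc k)))\<^sup>2 \<le> (d + inverse (real (Suc N)))\<^sup>2" if "N \<le> k" for k
        using d0 that by (intro power_mono) (auto simp: field_simps)
      from this[OF mn(1)] this[OF mn(2)] have "(norm (Y m - Y n))\<^sup>2 < e\<^sup>2"
        using dist_Y[of m n] N by linarith
      then show "norm (Y m - Y n) < e" using e by (simp add: power_less_imp_less_base)
    qed
  qed
  then obtain y where lim_y: "Y \<longlonglongrightarrow> y" using Cauchy_convergent convergent_def by blast
  have yS: "y \<in> S" using closed_sequentially[OF \<open>closed S\<close> _ lim_y] Y by blast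
  have "norm (x - y) \<le> d + 0"
  proof (rule LIMSEQ_le)
    show "(\<lambda>n. norm (x - Y n)) \<longlonglongrightarrow> norm (x - y)" by (intro tendsto_intros lim_y)
    show "(\<lambda>n. d + inverse (real (Suc n))) \<longlonglongrightarrow> d + 0"
      by (intro tendsto_intros LIMSEQ_inverse_real_of_nat)
  qed (use Yd less_imp_le in blast)
  then have y_min: "norm (x - y) \<le> norm (x - z)" if "z \<in> S" for z using d_le[OF that] by linarith
  have Re0: "Re (cinner z (x - y)) = 0" if z: "z \<in> S" for z
  proof -
    \<comment> \<open>Moving from y to y + t z never brings one closer to x. The resulting quadratic
      in t has constant term 0, so its linear coefficient must vanish.\<close>
    have "(- Re (cinner z (x - y)))\<^sup>2 \<le> 0 * (norm z)\<^sup>2"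
    proof (rule quadratic_nonneg_discriminant)
      fix t :: real
      have "y + t *\<^sub>R z \<in> S" by (intro sub(2,4) yS z)
      then have "(norm (x - y))\<^sup>2 \<le> (norm (x - (y + t *\<^sub>R z)))\<^sup>2"
        by (intro power_mono y_min) auto
      also have "\<dots> = (norm (x - y - t *\<^sub>R z))\<^sup>2" by (simp add: algebra_simps)
      also have "\<dots> = (norm (x - y))\<^sup>2 - 2 * t * Re (cinner z (x - y)) + t\<^sup>2 * (norm z)\<^sup>2"
        by (rule norm_diff_scaleR_sq)
      finally show "0 \<le> 0 + 2 * t * - Re (cinner z (x - y)) + t\<^sup>2 * (norm z)\<^sup>2" by simp
    qed simp
    then show ?thesis by simp
  qed
  have "cinner z (x - y) = 0" if z: "z \<in> S" for z
  proof -
    have "cinner (\<i> *\<^sub>C z) (x - y) = - \<i> * cinner z (x - y)" by (simp add: cinner_scaleC_left)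
    then have "Im (cinner z (x - y)) = 0" using Re0[OF sub(3)[OF z, of \<i>]] by simp
    then show ?thesis using Re0[OF z] by (simp add: complex_eq_iff)
  qed
  then show ?thesis using yS by blast
qed

lemma bounded_op_bounded_linear:
  assumes "bounded_op f"
  shows "bounded_linear f"
proof -
  obtain K where "\<And>x. norm (f x) \<le> norm x * K" using assms by (auto simp: bounded_op_def)
  then show ?thesis
    using assms by (intro bounded_linear_intro[of f K]) (auto simp: bounded_op_def scaleR_scaleC)
qed

text \<open>This is the Riesz representation of the continuous linear functional x \<mapsto>
  \<open>cinner y (f x)\<close>, with N as its kernel.\<close>

lemma adj_exists:
  fixes f :: "'h::chilbert_space \<Rightarrow> 'h"
  assumes f: "bounded_op f"
  shows "\<exists>w. \<forall>x. cinner (f x) y = cinner x w"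
proof -
  define N where "N = {x. cinner y (f x) = 0}"
  have add: "f (u + v) = f u + f v" and sc: "f (c *\<^sub>C u) = c *\<^sub>C f u" for u v c
    using f by (auto simp: bounded_op_def)
  have f_diff: "f (u - v) = f u - f v" for u v
    by (rule linear_diff[OF bounded_linear.linear[OF bounded_op_bounded_linear[OF f]]])
  have f0: "f 0 = 0" using f_diff[of 0 0] by simp
  have sub: "csubspace N"
    by (auto simp: csubspace_def N_def add sc f0 cinner_add_right cinner_scaleC_right)
  have "continuous_on UNIV (\<lambda>x. cinner y (f x))"
    by (rule linear_continuous_on, rule bounded_linear_compose[OF bounded_bilinear.bounded_linear_right[OF bounded_bilinear_cinner]])
      (rule bounded_op_bounded_linear[OF f])
  from closed_Collect_eq[OF this continuous_on_const] have "closed N" by (simp add: N_def)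
  show ?thesis
  proof (cases "N = UNIV")
    case True
    then have "\<forall>x. cinner y (f x) = 0" by (auto simp: N_def)
    then have "cinner (f x) y = cinner x 0" for x by (subst cinner_commute) simp
    then show ?thesis by blast
  next
    case False
    then obtain x0 where x0: "x0 \<notin> N" by blast
    obtain p where p: "p \<in> N" "\<forall>u\<in>N. cinner u (x0 - p) = 0"
      using orthogonal_projection_exists[OF sub \<open>closed N\<close>] by blast
    define z where "z = x0 - p"
    define \<phi> where "\<phi> x = cinner y (f x)" for x
    have z: "\<phi> z \<noteq> 0" using x0 p(1) by (auto simp: z_def \<phi>_def N_def f_diff cinner_diff_right)
    have "z \<noteq> 0" using z by (auto simp: \<phi>_def f0)
    then have zz: "cinner z z \<noteq> 0" by (simp add: cinner_eq_zero_iff)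
    \<comment> \<open>Since z is orthogonal to N and N has codimension one, w is a multiple of z;
      evaluation at x = z yields the coefficient.\<close>
    have "cinner (f x) y = cinner x ((cnj (\<phi> z) / cinner z z) *\<^sub>C z)" for x
    proof -
      have "x - (\<phi> x / \<phi> z) *\<^sub>C z \<in> N"
        using z by (simp add: N_def f_diff sc cinner_diff_right cinner_scaleC_right \<phi>_def)
      then have "cinner (x - (\<phi> x / \<phi> z) *\<^sub>C z) z = 0" using p(2) by (auto simp: z_def)
      then have eq: "cinner x z = cnj (\<phi> x / \<phi> z) * cinner z z"
        by (simp add: cinner_diff_left cinner_scaleC_left)
      have "cinner (f x) y = cnj (\<phi> x)" unfolding \<phi>_def by (rule cinner_commute)
      also have "\<dots> = cnj (\<phi> z) / cinner z z * (cnj (\<phi> x / \<phi> z) * cinner z z)"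
        using z zz by simp
      finally show ?thesis by (simp only: cinner_scaleC_right eq)
    qed
    then show ?thesis by blast
  qed
qed

lemma cinner_adj:
  assumes "bounded_op f"
  shows "cinner (f x) y = cinner x (adj f y)"
proof -
  obtain g where g: "\<And>x y. cinner (f x) y = cinner x (g y)"
    using adj_exists[OF assms] by metis
  have "adj f = g" unfolding adj_def
  proof (rule the_equality)
    fix h assume h: "\<forall>x y. cinner (f x) y = cinner x (h y)"
    show "h = g" by (rule ext, rule cinner_eqI) (simp add: g[symmetric] h[rule_format, symmetric])
  qed (use g in blast)
  then show ?thesis using g[of x y] by simp
qed

lemma adj_self:
  assumes "\<And>x y. cinner (f x) y = cinner x (f y)"
  shows "adj f = f"
  unfolding adj_def
proof (rule the_equality)
  fix h assume h: "\<forall>x y. cinner (f x) y = cinner x (h y)"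
  show "h = f" by (rule ext, rule cinner_eqI) (simp add: assms[symmetric] h[rule_format, symmetric])
qed (use assms in blast)

section \<open>The algebra of bounded operators\<close>

text \<open>A type of its own makes ring arithmetic, the operator norm and convergent series of
  operators available; \<open>app\<close> leads back to the functions of the statement.\<close>

typedef (overloaded) 'h bop = "{f :: 'h::chilbert_space \<Rightarrow> 'h. bounded_op f}"
  morphisms app Bop
proof (rule exI[of _ "\<lambda>x. x"], rule CollectI)
  show "bounded_op (\<lambda>x :: 'h. x)" unfolding bounded_op_def by (auto intro!: exI[of _ 1])
qed

setup_lifting type_definition_bop

lemma bounded_op_iff:
  "bounded_op f \<longleftrightarrow> bounded_linear f \<and> (\<forall>c x. f (c *\<^sub>C x) = c *\<^sub>C f x)"
proof
  assume "bounded_op f"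
  then show "bounded_linear f \<and> (\<forall>c x. f (c *\<^sub>C x) = c *\<^sub>C f x)"
    using bounded_op_bounded_linear by (auto simp: bounded_op_def)
next
  assume "bounded_linear f \<and> (\<forall>c x. f (c *\<^sub>C x) = c *\<^sub>C f x)"
  then show "bounded_op f"
    using bounded_linear.bounded[of f] linear_add[OF bounded_linear.linear, of f]
    by (auto simp: bounded_op_def)
qed

lemma scaleC_zero_right: "c *\<^sub>C (0 :: 'h::complex_vector) = 0"
  using scaleC_add_right[of c 0 "0 :: 'h"] by simp

lemma scaleC_minus_right: "c *\<^sub>C (- x) = - (c *\<^sub>C (x :: 'h::complex_vector))"
  using scaleC_add_right[of c x "- x"] by (simp add: scaleC_zero_right eq_neg_iff_add_eq_0 add.commute)

lemma scaleC_scaleR_commute: "c *\<^sub>C (r *\<^sub>R x) = r *\<^sub>R (c *\<^sub>C (x :: 'h::complex_vector))"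
  by (simp add: scaleR_scaleC scaleC_scaleC mult.commute)

lemma bounded_linear_scaleC: "bounded_linear ((*\<^sub>C) c :: 'h::complex_inner \<Rightarrow> 'h)"
  by (rule bounded_linear_intro[of _ "cmod c"])
    (simp_all add: scaleC_add_right scaleC_scaleR_commute norm_scaleC)

instance chilbert_space \<subseteq> banach ..

instantiation bop :: (chilbert_space) real_normed_vector
begin

lift_definition norm_bop :: "'a bop \<Rightarrow> real" is onorm .

lift_definition zero_bop :: "'a bop" is "\<lambda>x. 0"
  by (simp add: bounded_op_iff scaleC_zero_right)

lift_definition uminus_bop :: "'a bop \<Rightarrow> 'a bop" is "\<lambda>f x. - f x"
  by (simp add: bounded_op_iff scaleC_minus_right bounded_linear_minus)

lift_definition plus_bop :: "'a bop \<Rightarrow> 'a bop \<Rightarrow> 'a bop" is "\<lambda>f g x. f x + g x"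
  by (simp add: bounded_op_iff scaleC_add_right bounded_linear_add)

lift_definition minus_bop :: "'a bop \<Rightarrow> 'a bop \<Rightarrow> 'a bop" is "\<lambda>f g x. f x - g x"
  unfolding bounded_op_iff
  by (auto intro!: bounded_linear_sub simp: scaleC_add_right[of _ _ "- _", simplified scaleC_minus_right, simplified])

lift_definition scaleR_bop :: "real \<Rightarrow> 'a bop \<Rightarrow> 'a bop" is "\<lambda>r f x. r *\<^sub>R f x"
  by (auto simp: bounded_op_iff scaleC_scaleR_commute bounded_linear_const_scaleR)

definition sgn_bop :: "'a bop \<Rightarrow> 'a bop" where "sgn_bop x = scaleR (inverse (norm x)) x"

definition dist_bop :: "'a bop \<Rightarrow> 'a bop \<Rightarrow> real" where "dist_bop a b = norm (a - b)"

definition "(uniformity :: ('a bop \<times> 'a bop) filter) = (INF e\<in>{0 <..}. principal {(x, y). dist x y < e})"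

definition open_bop :: "'a bop set \<Rightarrow> bool"
  where "open_bop S = (\<forall>x\<in>S. \<forall>\<^sub>F (x', y) in uniformity. x' = x \<longrightarrow> y \<in> S)"

instance
  apply standard
  unfolding dist_bop_def open_bop_def sgn_bop_def uniformity_bop_def
  apply (rule refl | (transfer, force simp: bounded_op_iff onorm_triangle onorm_scaleR onorm_eq_0 algebra_simps))+
  done

end

text \<open>On the zero space the identity equals 0 and has norm 0, so classes demanding 0 \<noteq>
  1 or a unit of norm 1 are out of reach.\<close>

instantiation bop :: (chilbert_space) "{real_normed_algebra, monoid_mult}"
begin

lift_definition one_bop :: "'a bop" is "\<lambda>x. x"
  by (simp add: bounded_op_iff bounded_linear_ident)

lift_definition times_bop :: "'a bop \<Rightarrow> 'a bop \<Rightarrow> 'a bop" is "\<lambda>f g x. f (g x)"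
  by (auto simp: bounded_op_iff intro: bounded_linear_compose)

instance
proof
  fix a b c :: "'a bop" and r :: real
  show "a * b * c = a * (b * c)" by transfer simp
  show "(a + b) * c = a * c + b * c" by transfer simp
  show "a * (b + c) = a * b + a * c"
    by transfer (simp add: bounded_op_def)
  show "r *\<^sub>R a * b = r *\<^sub>R (a * b)" by transfer simp
  show "a * r *\<^sub>R b = r *\<^sub>R (a * b)" by transfer (simp add: bounded_op_def scaleR_scaleC)
  show "norm (a * b) \<le> norm a * norm b"
    by transfer (use onorm_compose in \<open>force simp: bounded_op_iff o_def\<close>)
  show "1 * a = a" "a * 1 = a" by (transfer, simp)+
qed

end

lemma app_simps [simp]:
  "app 0 x = 0" "app 1 x = x" "app (- A) x = - app A x" "app (A + B) x = app A x + app B x"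
  "app (A - B) x = app A x - app B x" "app (A * B) x = app A (app B x)"
  "app (r *\<^sub>R A) x = r *\<^sub>R app A x"
  by (transfer, simp)+

lemma app_linear [simp]:
  "app A 0 = 0" "app A (- x) = - app A x" "app A (x + y) = app A x + app A y"
  "app A (x - y) = app A x - app A y" "app A (r *\<^sub>R x) = r *\<^sub>R app A x"
  "app A (c *\<^sub>C x) = c *\<^sub>C app A x"
  using app[of A] linear_0[of "app A"] linear_neg[of "app A"] linear_add[of "app A"]
    linear_diff[of "app A"] linear_scale[of "app A"]
  by (auto simp: bounded_op_iff bounded_linear.linear)

lemma bop_eqI: "(\<And>x. app A x = app B x) \<Longrightarrow> A = B"
  by transfer (rule ext)

lemma norm_app: "norm (app A x) \<le> norm A * norm x"
  by transfer (simp add: bounded_op_iff onorm)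

lemma norm_bop_le: "0 \<le> b \<Longrightarrow> (\<And>x. norm (app A x) \<le> b * norm x) \<Longrightarrow> norm A \<le> b"
  by transfer (simp add: onorm_bound)

lemma bounded_linear_app: "bounded_linear (app A)"
  using app[of A] by (simp add: bounded_op_iff)

lemma bounded_linear_app_left: "bounded_linear (\<lambda>A. app A x)"
  by (rule bounded_linear_intro[of _ "norm x"]) (simp_all add: norm_app)

text \<open>The operators embed isometrically into the complete space of bounded real-linear maps,
  and complex homogeneity survives pointwise limits.\<close>

instance bop :: (chilbert_space) banach
proof
  fix X :: "nat \<Rightarrow> 'a bop"
  assume X: "Cauchy X"
  have tr: "dist (Blinfun (app A)) (Blinfun (app B)) = dist A B" for A B :: "'a bop"
  proof -
    have "Blinfun (app A) - Blinfun (app B) = Blinfun (app (A - B))"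
      by (rule blinfun_eqI) (simp add: bounded_linear_Blinfun_apply bounded_linear_app blinfun.diff_left)
    then show ?thesis
      by (simp add: dist_norm norm_blinfun.rep_eq norm_bop.rep_eq bounded_linear_Blinfun_apply bounded_linear_app)
  qed
  from X have "Cauchy (\<lambda>n. Blinfun (app (X n)))" by (simp add: Cauchy_def tr)
  then obtain L where L: "(\<lambda>n. Blinfun (app (X n))) \<longlonglongrightarrow> L"
    using Cauchy_convergent convergent_def by blast
  have lim: "(\<lambda>n. app (X n) x) \<longlonglongrightarrow> blinfun_apply L x" for x
    using blinfun.tendsto[OF L tendsto_const[of x]]
    by (simp add: bounded_linear_Blinfun_apply bounded_linear_app)
  have "(\<lambda>n. app (X n) (c *\<^sub>C x)) \<longlonglongrightarrow> c *\<^sub>C blinfun_apply L x" for c x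
    using bounded_linear.tendsto[OF bounded_linear_scaleC lim[of x]] by simp
  then have "blinfun_apply L (c *\<^sub>C x) = c *\<^sub>C blinfun_apply L x" for c x
    using LIMSEQ_unique lim by blast
  then have bL: "bounded_op (blinfun_apply L)"
    by (simp add: bounded_op_iff blinfun.bounded_linear_right)
  then have "Blinfun (app (Bop (blinfun_apply L))) = L"
    by (simp add: Bop_inverse blinfun_apply_inverse)
  then have "dist (X n) (Bop (blinfun_apply L)) = dist (Blinfun (app (X n))) L" for n
    using tr[of "X n" "Bop (blinfun_apply L)"] by simp
  then have "X \<longlonglongrightarrow> Bop (blinfun_apply L)"
    using L by (simp add: lim_sequentially)
  then show "convergent X" by (auto simp: convergent_def)
qed

section \<open>Self-adjoint and positive operators\<close>

definition sa :: "'h::chilbert_space bop \<Rightarrow> bool" where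
  "sa A \<longleftrightarrow> (\<forall>x y. cinner (app A x) y = cinner x (app A y))"

definition pos :: "'h::chilbert_space bop \<Rightarrow> bool" where
  "pos A \<longleftrightarrow> (\<forall>x. Im (cinner (app A x) x) = 0 \<and> Re (cinner (app A x) x) \<ge> 0)"

lemma saD: "sa A \<Longrightarrow> cinner (app A x) y = cinner x (app A y)"
  by (simp add: sa_def)

text \<open>Polarisation over the complex numbers: the defect h of symmetry vanishes on the
  diagonal, so h x y + h y x = 0; inserting \<i> y for y gives h x y - h y x = 0 as well.\<close>

lemma pos_sa:
  assumes "pos A"
  shows "sa A"
proof -
  define h where "h x y = cinner (app A x) y - cinner x (app A y)" for x y
  have diag: "h x x = 0" for x
    unfolding h_def using assms by (subst (2) cinner_commute) (simp add: pos_def complex_eq_iff)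
  have alt: "h x y + h y x = 0" for x y
    using diag[of "x + y"] diag[of x] diag[of y] by (simp add: h_def cinner_simps algebra_simps)
  have "h x y = 0" for x y
  proof -
    have "\<i> * (h x y - h y x) = 0"
      using alt[of x "\<i> *\<^sub>C y"]
      by (simp add: h_def cinner_scaleC_left cinner_scaleC_right algebra_simps)
    then have "h x y - h y x = 0" by simp
    then have "2 * h x y = 0" using alt[of x y] by (simp add: algebra_simps)
    then show ?thesis by simp
  qed
  then show ?thesis by (simp add: sa_def h_def)
qed

lemma sa_Im_cinner: "sa A \<Longrightarrow> Im (cinner (app A x) x) = 0"
  using cinner_commute[of "app A x" x] saD[of A x x] by (simp add: complex_eq_iff)

lemma posI: "sa A \<Longrightarrow> (\<And>x. Re (cinner (app A x) x) \<ge> 0) \<Longrightarrow> pos A"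
  by (simp add: pos_def sa_Im_cinner)

lemma posD: "pos A \<Longrightarrow> Re (cinner (app A x) x) \<ge> 0"
  by (simp add: pos_def)

lemma sa_0 [simp]: "sa 0" and sa_1 [simp]: "sa 1"
  and sa_add [simp]: "sa A \<Longrightarrow> sa B \<Longrightarrow> sa (A + B)"
  and sa_diff [simp]: "sa A \<Longrightarrow> sa B \<Longrightarrow> sa (A - B)"
  and sa_scaleR [simp]: "sa A \<Longrightarrow> sa (r *\<^sub>R A)"
  and sa_sandwich: "sa A \<Longrightarrow> sa B \<Longrightarrow> sa (A * B * A)"
  and sa_square [simp]: "sa A \<Longrightarrow> sa (A * A)"
  by (simp_all add: sa_def cinner_simps)

lemma sa_times: "sa A \<Longrightarrow> sa B \<Longrightarrow> A * B = B * A \<Longrightarrow> sa (A * B)"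
  unfolding sa_def by (metis app_simps(6))

text \<open>This is the adjoint of the equation A * B = C. It supplies the second half of most
  commutation and orthogonality relations.\<close>

lemma sa_times_eqI:
  assumes "sa A" "sa B" "sa C" "A * B = C"
  shows "B * A = C"
proof (rule bop_eqI, rule cinner_eqI)
  fix x y
  have "cinner y (app (B * A) x) = cinner (app (A * B) y) x" using assms(1,2) by (simp add: saD)
  then show "cinner y (app (B * A) x) = cinner y (app C x)" using assms(3,4) by (simp add: saD)
qed

lemma pos_0 [simp]: "pos 0" and pos_1 [simp]: "pos 1"
  and pos_add [simp]: "pos A \<Longrightarrow> pos B \<Longrightarrow> pos (A + B)"
  and pos_scaleR: "pos A \<Longrightarrow> r \<ge> 0 \<Longrightarrow> pos (r *\<^sub>R A)"
  by (auto simp: pos_def cinner_simps cinner_ge_zero)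

lemma pos_sandwich: "pos A \<Longrightarrow> sa B \<Longrightarrow> pos (B * A * B)"
  by (simp add: pos_def saD)

lemma pos_square: "sa A \<Longrightarrow> pos (A * A)"
  using pos_sandwich[OF pos_1, of A] by simp

lemma pos_commuting_projection:
  assumes "pos A" "sa P" "P * P = P" "P * A = A * P"
  shows "pos (P * A)"
proof -
  have "P * A = P * A * P" using assms(3,4) by (metis mult.assoc)
  then show ?thesis using pos_sandwich[OF assms(1,2)] by simp
qed

lemma pos_Cauchy_Schwarz:
  assumes "pos A"
  shows "(Re (cinner (app A x) y))\<^sup>2 \<le> Re (cinner (app A x) x) * Re (cinner (app A y) y)"
proof (rule quadratic_nonneg_discriminant)
  fix t :: real
  have "Re (cinner (app A y) x) = Re (cinner (app A x) y)"
    using saD[OF pos_sa[OF assms], of y x] by (simp add: Re_cinner_commute)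
  moreover have "0 \<le> Re (cinner (app A (x + t *\<^sub>R y)) (x + t *\<^sub>R y))" by (rule posD[OF assms])
  ultimately show "0 \<le> Re (cinner (app A x) x) + 2 * t * Re (cinner (app A x) y)
      + t\<^sup>2 * Re (cinner (app A y) y)"
    by (simp add: cinner_simps algebra_simps power2_eq_square)
qed (rule posD[OF assms])

text \<open>In operator terms this is A * A \<le> A. Cauchy-Schwarz for the form of A at x and A x
  gives it after cancelling the squared norm of A x; the construction of the square root relies on
  it.\<close>

lemma pos_contraction_norm:
  assumes "pos A" "pos (1 - A)"
  shows "(norm (app A x))\<^sup>2 \<le> Re (cinner (app A x) x)"
proof -
  let ?n = "(norm (app A x))\<^sup>2"
  have "Re (cinner (app A (app A x)) (app A x)) \<le> ?n"
    using posD[OF assms(2), of "app A x"] by (simp add: cinner_simps norm_sq_cinner)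
  then have "Re (cinner (app A x) x) * Re (cinner (app A (app A x)) (app A x))
      \<le> Re (cinner (app A x) x) * ?n"
    using posD[OF assms(1)] by (rule mult_left_mono)
  with pos_Cauchy_Schwarz[OF assms(1), of x "app A x"]
  have "?n\<^sup>2 \<le> Re (cinner (app A x) x) * ?n"
    unfolding norm_sq_cinner by (rule order_trans)
  then have "?n * ?n \<le> Re (cinner (app A x) x) * ?n"
    by (simp only: power2_eq_square[of "_\<^sup>2"])
  moreover have "?n \<le> Re (cinner (app A x) x)" if "?n = 0"
    unfolding that by (rule posD[OF assms(1)])
  moreover have "?n \<noteq> 0 \<Longrightarrow> 0 < ?n" by simp
  ultimately show ?thesis by (meson mult_right_le_imp_le)
qed

lemma pos_null:
  assumes "pos A" "Re (cinner (app A x) x) = 0"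
  shows "app A x = 0"
proof -
  have "(Re (cinner (app A x) (app A x)))\<^sup>2 \<le> 0"
    using pos_Cauchy_Schwarz[OF assms(1), of x "app A x"] assms(2) by simp
  then show ?thesis by (simp flip: norm_sq_cinner)
qed

lemma sa_square_eq_0: "sa A \<Longrightarrow> A * A = 0 \<Longrightarrow> A = 0"
proof (rule bop_eqI)
  fix x assume "sa A" "A * A = 0"
  then have "cinner (app A x) (app A x) = 0" by (metis app_simps(1,6) cinner_zero_right saD)
  then show "app A x = app 0 x" by (simp add: cinner_eq_zero_iff)
qed

lemma pos_antisym: "pos A \<Longrightarrow> pos (- A) \<Longrightarrow> A = 0"
proof (rule bop_eqI)
  fix x assume "pos A" "pos (- A)"
  then have "Re (cinner (app A x) x) = 0"
    using posD[of A x] posD[of "- A" x] by (simp add: cinner_simps)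
  then show "app A x = app 0 x" using pos_null[OF \<open>pos A\<close>] by simp
qed

section \<open>Square roots and absolute values\<close>

text \<open>The Taylor coefficients of (1 - t)^(1/2) at t = 0.\<close>

definition sqrt_coeff :: "nat \<Rightarrow> real" where
  "sqrt_coeff n = (- 1) ^ n * ((1/2) gchoose n)"

lemma sqrt_coeff_0 [simp]: "sqrt_coeff 0 = 1"
  by (simp add: sqrt_coeff_def)

text \<open>The recursion carries sign information: for a = 1/2 the factor k - a is positive from k
  = 1 on, for a = -1/2 it is always positive.\<close>

lemma gbinomial_Suc_signed:
  fixes a :: real
  shows "real (Suc k) * ((- 1) ^ Suc k * (a gchoose Suc k)) = (real k - a) * ((- 1) ^ k * (a gchoose k))"
proof -
  have "real (Suc k) * (a gchoose Suc k) = (a - real k) * (a gchoose k)"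
    using gbinomial_mult_1[of a k] by (simp add: algebra_simps)
  then have "(- 1) ^ Suc k * (real (Suc k) * (a gchoose Suc k)) = (- 1) ^ Suc k * ((a - real k) * (a gchoose k))"
    by (simp only:)
  then show ?thesis by (simp add: algebra_simps)
qed

lemma sqrt_coeff_Suc_le_0: "sqrt_coeff (Suc n) \<le> 0"
proof (induction n)
  case 0
  then show ?case by (simp add: sqrt_coeff_def)
next
  case (Suc n)
  have "real (Suc (Suc n)) * sqrt_coeff (Suc (Suc n)) = (real (Suc n) - 1/2) * sqrt_coeff (Suc n)"
    unfolding sqrt_coeff_def by (rule gbinomial_Suc_signed)
  also have "\<dots> \<le> 0" using Suc by (simp add: mult_le_0_iff)
  finally show ?case by (simp add: mult_le_0_iff)
qed

text \<open>Partial sums are the coefficients of (1 - t)^(1/2) / (1 - t) = (1 - t)^(-1/2), all of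
  which are nonnegative.\<close>

lemma sum_sqrt_coeff_nonneg: "0 \<le> (\<Sum>k\<le>n. sqrt_coeff k)"
proof -
  have "0 \<le> (- 1) ^ n * ((- (1/2) :: real) gchoose n)"
  proof (induction n)
    case (Suc n)
    have "0 \<le> (real n - (- (1/2))) * ((- 1) ^ n * ((- (1/2) :: real) gchoose n))"
      by (rule mult_nonneg_nonneg[OF _ Suc]) simp
    then have "0 \<le> real (Suc n) * ((- 1) ^ Suc n * ((- (1/2) :: real) gchoose Suc n))"
      by (simp only: gbinomial_Suc_signed)
    moreover have "0 \<le> y" if "0 \<le> real (Suc n) * y" for y
      using that by (simp only: zero_le_mult_iff) simp
    ultimately show ?case by blast
  qed simp
  then show ?thesis
    using gbinomial_sum_lower_neg[of "1/2 :: real" n] by (simp add: sqrt_coeff_def mult.commute)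
qed

text \<open>All coefficients after the leading 1 are nonpositive, so their absolute values add up to
  1 minus a nonnegative partial sum. The exact bound 1, beyond mere summability, later yields
  positivity of the root.\<close>

lemma sqrt_coeff_partial_sum: "(\<Sum>k<n. \<bar>sqrt_coeff (Suc k)\<bar>) \<le> 1"
proof -
  have "(\<Sum>k<n. \<bar>sqrt_coeff (Suc k)\<bar>) = - (\<Sum>k<n. sqrt_coeff (Suc k))"
    using sqrt_coeff_Suc_le_0 by (simp add: abs_of_nonpos sum_negf)
  also have "\<dots> = 1 - (\<Sum>k\<le>n. sqrt_coeff k)"
    by (simp add: sum.atMost_shift)
  finally show ?thesis using sum_sqrt_coeff_nonneg[of n] by simp
qed

lemma sqrt_coeff_summable_Suc: "summable (\<lambda>n. \<bar>sqrt_coeff (Suc n)\<bar>)"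
  by (rule summableI_nonneg_bounded[OF _ sqrt_coeff_partial_sum]) simp

lemma sqrt_coeff_summable: "summable (\<lambda>n. \<bar>sqrt_coeff n\<bar>)"
  using sqrt_coeff_summable_Suc by (subst (asm) summable_Suc_iff)

text \<open>The square of the series is 1 - t; Vandermonde's identity at 1/2 + 1/2 = 1.\<close>

lemma sqrt_coeff_convolution:
  "(\<Sum>i\<le>n. sqrt_coeff i * sqrt_coeff (n - i)) = (if n = 0 then 1 else if n = 1 then - 1 else 0)"
proof -
  have "(\<Sum>i\<le>n. sqrt_coeff i * sqrt_coeff (n - i))
      = (\<Sum>i\<le>n. (- 1) ^ n * (((1/2) gchoose i) * ((1/2) gchoose (n - i))))"
  proof (rule sum.cong[OF refl])
    fix i assume "i \<in> {..n}"
    then have sign: "(- 1 :: real) ^ i * (- 1) ^ (n - i) = (- 1) ^ n"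
      by (simp flip: power_add)
    have "sqrt_coeff i * sqrt_coeff (n - i)
        = ((- 1) ^ i * (- 1) ^ (n - i)) * (((1/2) gchoose i) * ((1/2) gchoose (n - i)))"
      unfolding sqrt_coeff_def by (simp only: mult_ac)
    then show "sqrt_coeff i * sqrt_coeff (n - i) = (- 1) ^ n * (((1/2) gchoose i) * ((1/2) gchoose (n - i)))"
      by (simp only: sign)
  qed
  also have "\<dots> = (- 1) ^ n * ((1/2 + 1/2 :: real) gchoose n)"
    unfolding gbinomial_Vandermonde[symmetric] by (simp add: sum_distrib_left atMost_atLeast0)
  also have "((1/2 + 1/2 :: real) gchoose n) = of_nat (1 choose n)"
    by (simp add: binomial_gbinomial)
  finally have eq: "(\<Sum>i\<le>n. sqrt_coeff i * sqrt_coeff (n - i)) = (- 1) ^ n * of_nat (1 choose n)" .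
  consider "n = 0" | "n = 1" | "1 < n" by linarith
  then show ?thesis unfolding eq by cases (simp_all add: binomial_eq_0)
qed

lemma norm_power_bop_le_1:
  fixes S :: "'h::chilbert_space bop"
  assumes "norm S \<le> 1"
  shows "norm (S ^ n) \<le> 1"
proof (induction n)
  case 0
  show ?case by (simp, rule norm_bop_le) simp_all
next
  case (Suc n)
  have "norm (S * S ^ n) \<le> norm S * norm (S ^ n)" by (rule norm_mult_ineq)
  also have "\<dots> \<le> 1" using assms Suc by (simp add: mult_le_one)
  finally show ?case by simp
qed

lemma sa_suminf:
  assumes "summable f" "\<And>n. sa (f n)"
  shows "sa (\<Sum>n. f n)"
  unfolding sa_def
proof (intro allI)
  fix x y
  note bl = bounded_bilinear.bounded_linear_left[OF bounded_bilinear_cinner, of y]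
    and br = bounded_bilinear.bounded_linear_right[OF bounded_bilinear_cinner, of x]
  have app: "(\<lambda>n. app (f n) z) sums app (\<Sum>n. f n) z" for z
    using bounded_linear.sums[OF bounded_linear_app_left summable_sums[OF assms(1)]] .
  have "(\<lambda>n. cinner (app (f n) x) y) sums cinner (app (\<Sum>n. f n) x) y"
    using bounded_linear.sums[OF bl app] .
  moreover have "(\<lambda>n. cinner (app (f n) x) y) sums cinner x (app (\<Sum>n. f n) y)"
    using bounded_linear.sums[OF br app, of y] assms(2) by (simp add: saD)
  ultimately show "cinner (app (\<Sum>n. f n) x) y = cinner x (app (\<Sum>n. f n) y)"
    by (rule sums_unique2)
qed

lemma sa_power: "sa S \<Longrightarrow> sa (S ^ n)"
  by (induction n) (simp_all add: sa_times power_commutes)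

text \<open>The root is the binomial series of \<open>sqrt (1 - S)\<close>, which still converges absolutely
  on the boundary of the unit ball.\<close>

lemma sqrt_exists_contraction:
  fixes S :: "'h::chilbert_space bop"
  assumes S: "sa S" "norm S \<le> 1"
  shows "\<exists>R. pos R \<and> R * R = 1 - S \<and> (\<forall>X. X * S = S * X \<longrightarrow> X * R = R * X)"
proof -
  define f where "f n = sqrt_coeff n *\<^sub>R S ^ n" for n
  define R where "R = (\<Sum>n. f n)"
  have norm_f: "norm (f n) \<le> \<bar>sqrt_coeff n\<bar>" for n
    using norm_power_bop_le_1[OF S(2), of n] by (simp add: f_def mult_left_le)
  have nsum: "summable (\<lambda>n. norm (f n))"
    by (rule summable_comparison_test[OF _ sqrt_coeff_summable]) (use norm_f in auto)
  then have sum: "summable f" by (rule summable_norm_cancel)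
  have "R * R = (\<Sum>k. \<Sum>i\<le>k. f i * f (k - i))"
    unfolding R_def by (rule Cauchy_product[OF nsum nsum])
  also have "\<dots> = (\<Sum>k. (if k = 0 then 1 else if k = 1 then - 1 else 0) *\<^sub>R S ^ k)"
  proof (rule suminf_cong)
    fix k
    have "(\<Sum>i\<le>k. f i * f (k - i)) = (\<Sum>i\<le>k. (sqrt_coeff i * sqrt_coeff (k - i)) *\<^sub>R S ^ k)"
      by (rule sum.cong) (auto simp: f_def simp flip: power_add)
    then show "(\<Sum>i\<le>k. f i * f (k - i)) = (if k = 0 then 1 else if k = 1 then - 1 else 0) *\<^sub>R S ^ k"
      by (simp only: scaleR_sum_left[symmetric] sqrt_coeff_convolution)
  qed
  also have "\<dots> = 1 - S"
    by (subst suminf_finite[of "{0, 1}"]) auto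
  finally have sq: "R * R = 1 - S" .
  have comm: "X * R = R * X" if "X * S = S * X" for X
  proof -
    have "X * S ^ n = S ^ n * X" for n using power_commuting_commutes[OF that[symmetric]] by simp
    then have "X * f n = f n * X" for n by (simp add: f_def)
    then show ?thesis
      unfolding R_def using suminf_mult[OF sum, of X] suminf_mult2[OF sum, of X] by simp
  qed
  have "pos R"
  proof (rule posI)
    show "sa R" unfolding R_def using sum by (rule sa_suminf) (simp add: f_def sa_power S)
    fix x
    \<comment> \<open>The constant term of the series is split off: the rest T has norm at most 1,
      so the form of R = 1 + T is nonnegative.\<close>
    define T where "T = (\<Sum>n. f (Suc n))"
    have R: "R = 1 + T"
      unfolding R_def T_def using suminf_split_head[OF sum] by (simp add: f_def algebra_simps)
    have nsum': "summable (\<lambda>n. norm (f (Suc n)))" using nsum by (subst summable_Suc_iff)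
    have "norm T \<le> (\<Sum>n. norm (f (Suc n)))" unfolding T_def by (rule summable_norm[OF nsum'])
    also have "\<dots> \<le> (\<Sum>n. \<bar>sqrt_coeff (Suc n)\<bar>)"
      by (rule suminf_le[OF norm_f nsum' sqrt_coeff_summable_Suc])
    also have "\<dots> \<le> 1" by (rule suminf_le_const[OF sqrt_coeff_summable_Suc sqrt_coeff_partial_sum])
    finally have "norm (app T x) \<le> 1 * norm x"
      using norm_app[of T x] by (meson mult_right_mono norm_ge_zero order_trans)
    then have "norm (app T x) * norm x \<le> norm x * norm x" by (simp add: mult_right_mono)
    then have "\<bar>Re (cinner (app T x) x)\<bar> \<le> (norm x)\<^sup>2"
      using abs_Re_cinner_le[of "app T x" x] by (simp add: power2_eq_square)
    then show "0 \<le> Re (cinner (app R x) x)"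
      by (simp add: R cinner_simps norm_sq_cinner)
  qed
  then show ?thesis using sq comm by blast
qed

text \<open>Scaling by k > \<open>norm D\<close> makes E, and hence S = 1 - E * E, a contraction;
  the summand 1 keeps k positive when D = 0. The commutation clause is what makes uniqueness
  provable afterwards.\<close>

lemma sqrt_exists:
  fixes D :: "'h::chilbert_space bop"
  assumes D: "sa D"
  shows "\<exists>R. pos R \<and> R * R = D * D \<and> (\<forall>X. X * (D * D) = D * D * X \<longrightarrow> X * R = R * X)"
proof -
  define k where "k = norm D + 1"
  have k: "k > 0" unfolding k_def by (smt (verit) norm_ge_zero)
  define E where "E = inverse k *\<^sub>R D"
  define S where "S = 1 - E * E"
  have E: "sa E" unfolding E_def using D by simp
  have EE: "D * D = k\<^sup>2 *\<^sub>R (E * E)" using k by (simp add: E_def power2_eq_square field_simps)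
  have cEE: "Re (cinner (app E (app E x)) x) = (norm (app E x))\<^sup>2" for x
    using E by (simp add: saD norm_sq_cinner)
  have normE: "norm (app E x) \<le> norm x" for x
  proof -
    have "norm (app D x) \<le> k * norm x"
      using norm_app[of D x] unfolding k_def by (simp add: distrib_right add_increasing2)
    then show ?thesis using k by (simp add: E_def field_simps)
  qed
  have pS: "pos S" unfolding S_def
  proof (rule posI)
    show "sa (1 - E * E)" using E by simp
    show "0 \<le> Re (cinner (app (1 - E * E) x) x)" for x
      using normE[of x] by (simp add: cinner_simps cEE norm_sq_cinner[symmetric] power_mono)
  qed
  have "pos (1 - S)" unfolding S_def using pos_square[OF E] by simp
  then have "norm (app S x) \<le> 1 * norm x" for x
  proof -
    have "(norm (app S x))\<^sup>2 \<le> Re (cinner (app S x) x)"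
      using pS \<open>pos (1 - S)\<close> by (rule pos_contraction_norm)
    also have "\<dots> \<le> (norm x)\<^sup>2"
      by (simp add: S_def cinner_simps cEE norm_sq_cinner[symmetric])
    finally show ?thesis unfolding mult_1 by (rule power2_le_imp_le) simp
  qed
  then have "norm S \<le> 1" by (intro norm_bop_le) auto
  then obtain R where R: "pos R" "R * R = 1 - S" "\<And>X. X * S = S * X \<Longrightarrow> X * R = R * X"
    using sqrt_exists_contraction[OF pos_sa[OF pS]] by blast
  show ?thesis
  proof (intro exI conjI allI impI)
    show "pos (k *\<^sub>R R)" using R(1) k by (simp add: pos_scaleR)
    show "k *\<^sub>R R * k *\<^sub>R R = D * D" using R(2) by (simp add: EE S_def power2_eq_square)
    fix X assume "X * (D * D) = D * D * X"
    then have "X * (E * E) = E * E * X" using k by (simp add: EE)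
    then have "X * R = R * X" by (intro R(3)) (simp add: S_def algebra_simps)
    then show "X * k *\<^sub>R R = k *\<^sub>R R * X" by simp
  qed
qed

text \<open>With d = R - Y, commutation gives d (R + Y) = R^2 - Y^2 = 0. Then d R d and d Y d are
  positive with sum 0, so both vanish, and d^3 = 0 forces d = 0 for self-adjoint d.\<close>

lemma sqrt_unique:
  assumes "pos R" "pos Y" "Y * Y = R * R" "Y * R = R * Y"
  shows "Y = R"
proof -
  define d where "d = R - Y"
  have d: "sa d" unfolding d_def using assms by (simp add: pos_sa)
  have "d * (R + Y) = 0" using assms(3,4) by (simp add: d_def algebra_simps)
  then have "d * R * d + d * Y * d = 0" by (metis distrib_left distrib_right mult_zero_left)
  then have neg: "d * Y * d = - (d * R * d)" by (simp add: eq_neg_iff_add_eq_0 add.commute)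
  have "d * R * d = 0"
    using pos_sandwich[OF assms(1) d] pos_sandwich[OF assms(2) d] unfolding neg by (rule pos_antisym)
  then have "d * (R - Y) * d = 0" using neg by (simp add: right_diff_distrib left_diff_distrib)
  then have "(d * d) * (d * d) = 0" by (simp add: d_def[symmetric] mult.assoc[symmetric])
  then have "d = 0" by (rule sa_square_eq_0[OF d sa_square_eq_0[OF sa_square[OF d]]])
  then show ?thesis by (simp add: d_def)
qed

section \<open>Passage between operators as functions and the type \<open>bop\<close>\<close>

lemma bounded_opE:
  assumes "bounded_op f"
  obtains A where "f = app A"
  using assms Bop_inverse by (metis mem_Collect_eq)

lemma bounded_op_app [simp]: "bounded_op (app A)"
  using app[of A] by simp

declare app_inject [simp]

lemma app_op_simps:
  "op_add (app A) (app B) = app (A + B)" "op_sub (app A) (app B) = app (A - B)"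
  "op_zero = app 0" "id = app 1" "app A \<circ> app B = app (A * B)"
  by (simp_all add: fun_eq_iff op_add_def op_sub_def op_zero_def)

lemma op_pos_app: "op_pos (app A) \<longleftrightarrow> pos A"
  by (simp add: op_pos_def pos_def)

lemma op_le_app: "op_le (app A) (app B) \<longleftrightarrow> pos (B - A)"
  by (simp add: op_le_def app_op_simps op_pos_app)

lemma adj_app: "sa A \<Longrightarrow> adj (app A) = app A"
  by (rule adj_self) (rule saD)

text \<open>Any positive root Y of D * D commutes with Y * Y = D * D, hence with the constructed
  root R, and so equals it. This resolves the definite description in
  \<open>op_sqrt\<close>.\<close>

lemma op_abs_exists:
  assumes "sa D"
  shows "\<exists>R. op_abs (app D) = app R \<and> pos R \<and> R * R = D * D \<and> (\<forall>Y. pos Y \<and> Y * Y = D * D \<longrightarrow> Y = R)"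
proof -
  obtain R where R: "pos R" "R * R = D * D" "\<And>X. X * (D * D) = D * D * X \<Longrightarrow> X * R = R * X"
    using sqrt_exists[OF assms] by blast
  have uniq: "Y = R" if "pos Y" "Y * Y = D * D" for Y
    using R(1) that(1)
  proof (rule sqrt_unique)
    show "Y * R = R * Y" by (rule R(3)) (simp add: mult.assoc flip: that(2))
  qed (simp add: R(2) that(2))
  have "op_abs (app D) = app R"
    unfolding op_abs_def op_sqrt_def adj_app[OF assms] app_op_simps
  proof (rule the_equality)
    fix y assume y: "op_pos y \<and> y \<circ> y = app (D * D)"
    then obtain Y where "y = app Y" using bounded_opE op_pos_def by metis
    with y uniq[of Y] show "y = app R" by (simp add: op_pos_app app_op_simps)
  qed (simp add: R op_pos_app app_op_simps)
  then show ?thesis using R(1,2) uniq by blast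
qed

lemma op_abs_app_eqI: "sa D \<Longrightarrow> pos R \<Longrightarrow> R * R = D * D \<Longrightarrow> op_abs (app D) = app R"
  using op_abs_exists by blast

text \<open>For commuting A and B this is A (1 - B) + (1 - A) B, the analogue of a symmetric
  difference.\<close>

definition modulus :: "'h::chilbert_space bop \<Rightarrow> 'h bop \<Rightarrow> 'h bop" where
  "modulus A B = A + B - A * B - B * A"

text \<open>An equation between polynomials and two positivity conditions replace the absolute
  values, so that compression by commuting projections can be computed.\<close>

definition ac :: "'h::chilbert_space bop \<Rightarrow> 'h bop \<Rightarrow> bool" where
  "ac A B \<longleftrightarrow> pos (modulus A B) \<and> pos (1 - modulus A B) \<and>
    modulus A B * modulus A B = (A - B) * (A - B)"

text \<open>Both sides are 1 - 2 X with X = \<open>modulus A B\<close>. Hence the equation of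
  squares for A - B carries over to 1 - A - B with 1 - X in place of X.\<close>

lemma modulus_square_diff:
  "(1 - modulus A B) * (1 - modulus A B) - modulus A B * modulus A B
    = (1 - A - B) * (1 - A - B) - (A - B) * (A - B)"
  unfolding modulus_def by (simp add: algebra_simps)

lemma modulus_commute: "modulus A B = modulus B A"
  by (simp add: modulus_def algebra_simps)

lemma modulus_compl: "modulus (1 - A) B = 1 - modulus A B"
  by (simp add: modulus_def algebra_simps)

text \<open>If \<open>|A - B| + |1 - A - B| = 1\<close>, comparing squares forces \<open>|A - B|\<close> to be
  \<open>A + B - A B - B A\<close>.\<close>

lemma abs_compatible_app:
  assumes "sa A" "sa B"
  shows "abs_compatible (app A) (app B) \<longleftrightarrow> ac A B"
proof -
  define X where "X = modulus A B"
  note sq = modulus_square_diff[of A B, folded X_def]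
  have sa: "sa (A - B)" "sa (1 - A - B)" using assms by auto
  have eq: "abs_compatible (app A) (app B) \<longleftrightarrow> op_add (op_abs (app (A - B))) (op_abs (app (1 - A - B))) = app 1"
    by (simp add: abs_compatible_def app_op_simps)
  show ?thesis
  proof
    assume c: "abs_compatible (app A) (app B)"
    obtain R R' where R: "op_abs (app (A - B)) = app R" "pos R" "R * R = (A - B) * (A - B)"
      and R': "op_abs (app (1 - A - B)) = app R'" "pos R'" "R' * R' = (1 - A - B) * (1 - A - B)"
      using op_abs_exists[OF sa(1)] op_abs_exists[OF sa(2)] by blast
    have "R + R' = 1" using c by (simp add: eq R R' app_op_simps)
    then have R'_eq: "R' = 1 - R" by (simp add: algebra_simps)
    have "(1 - R) * (1 - R) - R * R = (1 - X) * (1 - X) - X * X"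
      using sq R(3) R'(3) by (simp add: R'_eq)
    then have "R + R = X + X" by (simp add: algebra_simps)
    then have "2 *\<^sub>R R = 2 *\<^sub>R X" by (simp add: scaleR_2)
    then have "R = X" by simp
    then show "ac A B" using R R' R'_eq by (simp add: ac_def X_def)
  next
    assume "ac A B"
    then have X: "pos X" "pos (1 - X)" "X * X = (A - B) * (A - B)"
      by (simp_all add: ac_def X_def)
    then have "(1 - X) * (1 - X) = (1 - A - B) * (1 - A - B)" using sq by simp
    then show "abs_compatible (app A) (app B)"
      using op_abs_app_eqI[OF sa(1) X(1,3)] op_abs_app_eqI[OF sa(2) X(2)]
      by (simp add: eq app_op_simps)
  qed
qed

section \<open>Range projections\<close>

definition isproj :: "'h::chilbert_space bop \<Rightarrow> bool" where
  "isproj P \<longleftrightarrow> sa P \<and> P * P = P"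

lemma isprojD: "isproj P \<Longrightarrow> sa P" "isproj P \<Longrightarrow> P * P = P"
  "isproj P \<Longrightarrow> app P (app P x) = app P x"
  using app_simps(6)[of P P x] by (auto simp: isproj_def)

lemma isproj_pos: "isproj P \<Longrightarrow> pos P"
  using pos_square[of P] by (simp add: isproj_def)

lemma isproj_compl: "isproj P \<Longrightarrow> isproj (1 - P)"
  by (simp add: isproj_def algebra_simps)

lemma is_projection_app: "is_projection (app P) \<longleftrightarrow> isproj P"
proof
  assume p: "is_projection (app P)"
  then have "sa P" unfolding sa_def is_projection_def using cinner_adj[of "app P"] by simp
  then show "isproj P" using p by (simp add: is_projection_def isproj_def app_op_simps)
next
  assume "isproj P"
  then show "is_projection (app P)"
    by (simp add: is_projection_def isproj_def app_op_simps adj_app)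
qed

text \<open>A point of S with residual orthogonal to S is unique, and this uniqueness makes the
  nearest-point map p linear.\<close>

lemma projection_onto_exists:
  fixes S :: "'h::chilbert_space set"
  assumes S: "csubspace S" and "closed S"
  shows "\<exists>P. isproj P \<and> range (app P) = S"
proof -
  note sub = csubspaceD[OF S]
  obtain p where p: "\<And>x. p x \<in> S" "\<And>x z. z \<in> S \<Longrightarrow> cinner z (x - p x) = 0"
    using orthogonal_projection_exists[OF assms] by metis
  have uniq: "p x = y" if "y \<in> S" "\<And>z. z \<in> S \<Longrightarrow> cinner z (x - y) = 0" for x y
  proof -
    have "p x - y \<in> S" by (intro sub(5) p(1) that(1))
    then have "cinner (p x - y) ((x - y) - (x - p x)) = 0"
      by (simp only: cinner_diff_right[of _ "x - y" "x - p x"] p(2) that(2) diff_self)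
    then show ?thesis by (simp add: cinner_eq_zero_iff)
  qed
  have bd: "norm (p x) \<le> norm x" for x
  proof -
    have "(norm x)\<^sup>2 = (norm (p x + (x - p x)))\<^sup>2" by simp
    also have "\<dots> = (norm (p x))\<^sup>2 + (norm (x - p x))\<^sup>2 + 2 * Re (cinner (p x) (x - p x))"
      by (rule norm_add_sq)
    also have "\<dots> = (norm (p x))\<^sup>2 + (norm (x - p x))\<^sup>2" by (simp only: p(2)[OF p(1)]) simp
    finally have "(norm (p x))\<^sup>2 \<le> (norm x)\<^sup>2"
      using zero_le_power2[of "norm (x - p x)"] by linarith
    then show ?thesis by (rule power2_le_imp_le) simp
  qed
  have "p (x + y) = p x + p y" for x y
  proof (rule uniq)
    fix z assume "z \<in> S"
    then have "cinner z ((x - p x) + (y - p y)) = 0" by (simp only: cinner_add_right p(2) add_0)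
    then show "cinner z (x + y - (p x + p y)) = 0" by (simp add: algebra_simps)
  qed (intro sub(2) p(1))
  moreover have "p (c *\<^sub>C x) = c *\<^sub>C p x" for c x
  proof (rule uniq)
    fix z assume "z \<in> S"
    then have "c * cinner z (x - p x) = 0" by (simp only: p(2) mult_zero_right)
    then show "cinner z (c *\<^sub>C x - c *\<^sub>C p x) = 0"
      by (simp add: cinner_diff_right cinner_scaleC_right algebra_simps)
  qed (intro sub(3) p(1))
  moreover have "\<exists>K. \<forall>x. norm (p x) \<le> norm x * K" using bd by (intro exI[of _ 1]) simp
  ultimately have "bounded_op p" by (simp add: bounded_op_def)
  then obtain P where P: "p = app P" by (rule bounded_opE)
  have fix_S: "p y = y" if "y \<in> S" for y by (rule uniq) (use that in simp_all)
  have "sa P" unfolding sa_def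
  proof (intro allI)
    fix x y
    have "cinner (p y) (x - p x) = 0" using p by blast
    then have "cinner (x - p x) (p y) = 0" by (subst cinner_commute) simp
    then have "cinner x (p y) = cinner (p x) (p y)" by (simp add: cinner_diff_left)
    also have "\<dots> = cinner (p x) y" using p(2)[of "p x" y] p(1) by (simp add: cinner_diff_right)
    finally show "cinner (app P x) y = cinner x (app P y)" by (simp add: P)
  qed
  moreover have "P * P = P" by (rule bop_eqI) (use fix_S p(1) in \<open>simp flip: P\<close>)
  moreover have "range p = S" using p(1) fix_S by (metis image_subset_iff rangeI subsetI subset_antisym)
  ultimately show ?thesis using P by (auto simp: isproj_def)
qed

lemma csubspace_closure_range: "csubspace (closure (range (app T)))"
  unfolding csubspace_def
proof (intro conjI ballI allI)
  show "0 \<in> closure (range (app T))" using closure_subset[of "range (app T)"] rangeI[of "app T" 0] by auto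
next
  fix x y assume "x \<in> closure (range (app T))" "y \<in> closure (range (app T))"
  then obtain X Y where X: "\<And>n. X n \<in> range (app T)" "X \<longlonglongrightarrow> x"
    and Y: "\<And>n. Y n \<in> range (app T)" "Y \<longlonglongrightarrow> y"
    unfolding closure_sequential by blast
  have "X n + Y n \<in> range (app T)" for n using X(1)[of n] Y(1)[of n] by (auto simp flip: app_linear)
  moreover have "(\<lambda>n. X n + Y n) \<longlonglongrightarrow> x + y" by (intro tendsto_add X Y)
  ultimately show "x + y \<in> closure (range (app T))"
    unfolding closure_sequential by (intro exI[of _ "\<lambda>n. X n + Y n"]) simp
next
  fix c x assume "x \<in> closure (range (app T))"
  then obtain X where X: "\<And>n. X n \<in> range (app T)" "X \<longlonglongrightarrow> x"
    unfolding closure_sequential by blast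
  have "c *\<^sub>C X n \<in> range (app T)" for n using X(1)[of n] by (auto simp flip: app_linear)
  moreover from bounded_linear.tendsto[OF bounded_linear_scaleC X(2)] have "(\<lambda>n. c *\<^sub>C X n) \<longlonglongrightarrow> c *\<^sub>C x" .
  ultimately show "c *\<^sub>C x \<in> closure (range (app T))"
    unfolding closure_sequential by (intro exI[of _ "\<lambda>n. c *\<^sub>C X n"]) simp
qed

lemma isproj_range_eq:
  assumes P: "isproj P" and Q: "isproj Q" and eq: "range (app P) = range (app Q)"
  shows "P = Q"
proof -
  have "P * Q = Q" if PQ: "isproj P" "range (app P) = range (app Q)" for P Q :: "'a bop"
  proof (rule bop_eqI)
    fix x
    obtain z where "app Q x = app P z" using PQ(2) by blast
    then show "app (P * Q) x = app Q x" using isprojD(3)[OF PQ(1), of z] by simp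
  qed
  from this[OF P eq] this[OF Q eq[symmetric]] have "P * Q = Q" "Q * P = P" .
  then show ?thesis using sa_times_eqI[of P Q Q] isprojD[OF P] isprojD[OF Q] by simp
qed

definition rp :: "'h::chilbert_space bop \<Rightarrow> 'h bop" where
  "rp T = Bop (range_proj (app T))"

lemma rp_properties:
  shows "range_proj (app T) = app (rp T)" "isproj (rp T)" "range (app (rp T)) = closure (range (app T))"
proof -
  obtain P where P: "isproj P" "range (app P) = closure (range (app T))"
    using projection_onto_exists[OF csubspace_closure_range closed_closure] by blast
  have "range_proj (app T) = app P"
    unfolding range_proj_def
  proof (rule the_equality)
    fix q assume q: "is_projection q \<and> range q = closure (range (app T))"
    then obtain Q where "q = app Q" using bounded_opE is_projection_def by metis
    with q isproj_range_eq[of Q P] P show "q = app P" by (simp add: is_projection_app)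
  qed (simp add: P is_projection_app)
  then have "rp T = P" by (simp add: rp_def app_inverse)
  then show "range_proj (app T) = app (rp T)" "isproj (rp T)" "range (app (rp T)) = closure (range (app T))"
    using \<open>range_proj (app T) = app P\<close> P by simp_all
qed

lemma closed_kernel: "closed {x. app A x = 0}"
  by (rule closed_Collect_eq[OF linear_continuous_on[OF bounded_linear_app] continuous_on_const])

lemma rp_annihilate: "A * T = 0 \<Longrightarrow> A * rp T = 0"
proof (rule bop_eqI)
  fix x assume "A * T = 0"
  then have "range (app T) \<subseteq> {x. app A x = 0}"
    by (metis (mono_tags, lifting) app_simps(1,6) image_subsetI mem_Collect_eq)
  then have "closure (range (app T)) \<subseteq> {x. app A x = 0}" by (rule closure_minimal) (rule closed_kernel)
  then show "app (A * rp T) x = app 0 x" using rp_properties(3)[of T] by auto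
qed

lemma rp_times: "rp T * T = T"
proof (rule bop_eqI)
  fix x
  have "app T x \<in> range (app (rp T))"
    unfolding rp_properties(3) by (rule subsetD[OF closure_subset rangeI])
  then show "app (rp T * T) x = app T x" using isprojD(3)[OF rp_properties(2)[of T]] by auto
qed

lemma times_rp: "sa T \<Longrightarrow> T * rp T = T"
  by (rule sa_times_eqI[OF isprojD(1)[OF rp_properties(2)] _ _ rp_times])

text \<open>For self-adjoint T the kernel is the orthogonal complement of the range, and
  orthogonality to x passes to the closure of the range.\<close>

lemma rp_kernel:
  assumes "sa T"
  shows "app (rp T) x = 0 \<longleftrightarrow> app T x = 0"
proof
  assume "app (rp T) x = 0"
  then have "app (T * rp T) x = 0" by simp
  then show "app T x = 0" by (simp only: times_rp[OF assms])
next
  assume T: "app T x = 0"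
  have "range (app T) \<subseteq> {z. cinner z x = 0}" using T by (auto simp: saD[OF assms])
  moreover have "closed {z. cinner z x = 0}"
    by (rule closed_Collect_eq[OF linear_continuous_on continuous_on_const])
      (rule bounded_bilinear.bounded_linear_left[OF bounded_bilinear_cinner])
  ultimately have "closure (range (app T)) \<subseteq> {z. cinner z x = 0}" by (rule closure_minimal)
  then have "cinner (app (rp T) (app (rp T) x)) x = 0" using rp_properties(3)[of T] by auto
  then have "cinner (app (rp T) x) (app (rp T) x) = 0"
    by (simp only: saD[OF isprojD(1)[OF rp_properties(2)]])
  then show "app (rp T) x = 0" by (simp add: cinner_eq_zero_iff)
qed

text \<open>X leaves both the closed range and the kernel of T invariant. Since X runs through a
  commutant and may fail to be self-adjoint, each invariance contributes one of the two
  identities.\<close>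

lemma rp_commute:
  assumes "sa T" "X * T = T * X"
  shows "X * rp T = rp T * X"
proof -
  have "(1 - rp T) * X * T = 0"
    using assms(2) rp_times[of T] by (simp add: left_diff_distrib mult.assoc) (simp flip: mult.assoc)
  then have "(1 - rp T) * X * rp T = 0" by (rule rp_annihilate)
  then have 1: "X * rp T = rp T * X * rp T" by (simp add: left_diff_distrib)
  have "rp T * X * (1 - rp T) = 0"
  proof (rule bop_eqI)
    fix x
    have "app T (app (1 - rp T) x) = 0"
      using times_rp[OF assms(1)] by (simp flip: app_simps(6))
    then have "app T (app X (app (1 - rp T) x)) = 0"
      using assms(2) by (metis app_linear(1) app_simps(6))
    then show "app (rp T * X * (1 - rp T)) x = app 0 x"
      unfolding app_simps(6) rp_kernel[OF assms(1)] app_simps(1) by simp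
  qed
  then have 2: "rp T * X = rp T * X * rp T" by (simp add: right_diff_distrib)
  show ?thesis by (rule trans[OF 1 2[symmetric]])
qed

text \<open>Invariance of the kernel says P X = P X P; for self-adjoint X the adjoint of this
  equation gives X P = P X P.\<close>

lemma isproj_commute:
  assumes "isproj P" "sa X" "\<And>y. app P y = 0 \<Longrightarrow> app P (app X y) = 0"
  shows "P * X = X * P"
proof -
  have "P * X * (1 - P) = 0"
  proof (rule bop_eqI)
    fix x
    have "app P (app (1 - P) x) = 0" using isprojD(3)[OF assms(1)] by simp
    from assms(3)[OF this] show "app (P * X * (1 - P)) x = app 0 x" by (simp only: app_simps)
  qed
  then have 1: "P * X = P * X * P" by (simp add: right_diff_distrib)
  have "sa (P * X * P)" using isprojD(1)[OF assms(1)] assms(2) by (rule sa_sandwich)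
  then have "X * P = P * X * P"
    using sa_times_eqI[OF isprojD(1)[OF assms(1)] assms(2) _ 1] by blast
  with 1 show ?thesis by (rule trans[OF _ sym])
qed

lemma isproj_kernel_eq:
  assumes P: "isproj P" and Q: "isproj Q" and eq: "\<And>x. app P x = 0 \<longleftrightarrow> app Q x = 0"
  shows "P = Q"
proof -
  have "P * Q = P" if "isproj P" "isproj Q" "\<And>x. app P x = 0 \<longleftrightarrow> app Q x = 0" for P Q :: "'a bop"
  proof (rule bop_eqI)
    fix x
    have "app Q (x - app Q x) = 0" using isprojD(3)[OF that(2)] by simp
    then have "app P (x - app Q x) = 0" by (simp only: that(3))
    then show "app (P * Q) x = app P x" by simp
  qed
  from this[OF P Q eq] this[OF Q P eq[symmetric]] have "P * Q = P" "Q * P = Q" .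
  then show ?thesis using sa_times_eqI[of P Q P] isprojD[OF P] isprojD[OF Q] by simp
qed

section \<open>Support projections of positive contractions\<close>

definition contr :: "'h::chilbert_space bop \<Rightarrow> bool" where
  "contr A \<longleftrightarrow> pos A \<and> pos (1 - A)"

definition supp :: "'h::chilbert_space bop \<Rightarrow> 'h bop" where
  "supp C = 1 - rp (1 - C)"

definition ast :: "'h::chilbert_space bop \<Rightarrow> 'h bop" where
  "ast C = C - supp C"

definition null :: "'h::chilbert_space bop \<Rightarrow> 'h bop" where
  "null C = 1 - rp C"

lemma app_proj_simps:
  "range_proj (app C) = app (rp C)" "supp_proj (app C) = app (supp C)"
  "ast_part (app C) = app (ast C)" "null_proj (app C) = app (null C)"
  by (simp_all add: rp_properties supp_proj_def ast_part_def null_proj_def supp_def ast_def null_def app_op_simps)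

lemma contrD: "contr A \<Longrightarrow> pos A" "contr A \<Longrightarrow> pos (1 - A)" "contr A \<Longrightarrow> sa A"
  by (auto simp: contr_def pos_sa)

lemma contr_compl: "contr A \<Longrightarrow> contr (1 - A)"
  by (simp add: contr_def)

text \<open>Transfers each fact about the eigenspace for 1 to the kernel by passing to 1 -
  C.\<close>

lemma null_supp: "null C = supp (1 - C)"
  by (simp add: null_def supp_def)

lemma isproj_supp: "isproj (supp C)" and isproj_null: "isproj (null C)"
  by (simp_all add: supp_def null_def isproj_compl rp_properties)

lemma supp_fix: "sa C \<Longrightarrow> app (supp C) x = x \<longleftrightarrow> app C x = x"
  using rp_kernel[of "1 - C" x] by (auto simp: supp_def)

lemma null_fix: "sa C \<Longrightarrow> app (null C) x = x \<longleftrightarrow> app C x = 0"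
  using rp_kernel[of C x] by (auto simp: null_def)

lemma supp_mult:
  assumes "sa C"
  shows "C * supp C = supp C" "supp C * C = supp C"
proof -
  show 1: "C * supp C = supp C"
  proof (rule bop_eqI)
    fix x
    have "app (supp C) (app (supp C) x) = app (supp C) x" by (rule isprojD(3)[OF isproj_supp])
    then show "app (C * supp C) x = app (supp C) x" by (simp only: supp_fix[OF assms] app_simps)
  qed
  show "supp C * C = supp C"
    by (rule sa_times_eqI[OF assms _ _ 1]) (rule isprojD(1)[OF isproj_supp])+
qed

lemma null_mult:
  assumes "sa C"
  shows "C * null C = 0" "null C * C = 0"
  using supp_mult[of "1 - C"] assms by (simp_all add: null_supp left_diff_distrib right_diff_distrib)

lemma supp_null_orthogonal:
  assumes "sa C"
  shows "supp C * null C = 0" "null C * supp C = 0"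
proof -
  have "supp C * null C = supp C * C * null C" by (simp only: supp_mult(2)[OF assms])
  then show 1: "supp C * null C = 0" by (simp add: mult.assoc null_mult(1)[OF assms])
  show "null C * supp C = 0"
    by (rule sa_times_eqI[OF _ _ sa_0 1]) (rule isprojD(1)[OF isproj_supp] isprojD(1)[OF isproj_null])+
qed

text \<open>The two projections are compared through their kernels: C and \<open>supp C\<close>
  agree at x exactly when x - \<open>supp C\<close> x lies in the kernel of C. Commuting with
  r(e(C)) thus reduces to commuting with s(C) and n(C).\<close>

lemma rp_ast:
  assumes C: "sa C"
  shows "rp (ast C) = 1 - supp C - null C"
proof (rule isproj_kernel_eq[OF rp_properties(2)])
  note sp = isprojD[OF isproj_supp[of C]] and np = isprojD[OF isproj_null[of C]]
  show "isproj (1 - supp C - null C)"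
    unfolding isproj_def using sp np by (simp add: algebra_simps supp_null_orthogonal[OF C])
  fix x
  have "sa (ast C)" using C sp(1) by (simp add: ast_def)
  then have "app (rp (ast C)) x = 0 \<longleftrightarrow> app C x = app (supp C) x"
    by (simp add: rp_kernel ast_def)
  also have "\<dots> \<longleftrightarrow> app C (x - app (supp C) x) = 0"
    using arg_cong[OF supp_mult(1)[OF C], of "\<lambda>A. app A x"] by simp
  also have "\<dots> \<longleftrightarrow> app (null C) (x - app (supp C) x) = x - app (supp C) x"
    by (simp only: null_fix[OF C])
  also have "\<dots> \<longleftrightarrow> app (1 - supp C - null C) x = 0"
    using arg_cong[OF supp_null_orthogonal(2)[OF C], of "\<lambda>A. app A x"] by (auto simp: algebra_simps)
  finally show "app (rp (ast C)) x = 0 \<longleftrightarrow> app (1 - supp C - null C) x = 0" .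
qed

lemma isproj_commute_fix:
  assumes "isproj P" "sa X" "\<And>y. app P y = y \<Longrightarrow> app P (app X y) = app X y"
  shows "P * X = X * P"
proof -
  have "(1 - P) * X = X * (1 - P)"
    by (rule isproj_commute[OF isproj_compl[OF assms(1)] assms(2)]) (use assms(3) in auto)
  then show ?thesis by (simp add: left_diff_distrib right_diff_distrib)
qed

section \<open>Absolute compatibility\<close>

lemma ac_commute: "ac A B \<Longrightarrow> ac B A"
  unfolding ac_def modulus_commute[of B A] by (simp add: algebra_simps)

text \<open>Replacing A by 1 - A exchanges X and 1 - X, and likewise the two squares.\<close>

lemma ac_compl: "ac A B \<Longrightarrow> ac (1 - A) B"
  using modulus_square_diff[of A B] by (simp add: ac_def modulus_compl)

text \<open>The inequality A * A \<le> A makes the form of 1 - A nonpositive at x. Being positive as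
  well it vanishes there, and then 1 - A annihilates x.\<close>

lemma contr_norm_eq:
  assumes "contr A" "norm (app A x) = norm x"
  shows "app A x = x"
proof -
  have "Re (cinner (app (1 - A) x) x) \<le> 0"
    using pos_contraction_norm[OF contrD(1,2)[OF assms(1)], of x] assms(2)
    by (simp add: cinner_simps norm_sq_cinner)
  then have "Re (cinner (app (1 - A) x) x) = 0"
    using posD[OF contrD(2)[OF assms(1)], of x] by (rule antisym)
  from pos_null[OF contrD(2)[OF assms(1)] this] show ?thesis by simp
qed

text \<open>On the eigenspace of \<open>A\<close> for 1 the operator \<open>A + B - A B - B A\<close> acts as \<open>A (1 - B)\<close> while
  \<open>A - B\<close> acts as \<open>1 - B\<close>; equal squares mean equal norms.\<close>

lemma ac_eigenspace_invariant:
  assumes A: "contr A" and B: "contr B" and "ac A B" and x: "app A x = x"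
  shows "app A (app B x) = app B x"
proof -
  define X where "X = modulus A B"
  have X: "pos X" "X * X = (A - B) * (A - B)"
    using assms(3) by (simp_all add: ac_def X_def)
  have norm_sa: "(norm (app T x))\<^sup>2 = Re (cinner (app (T * T) x) x)" if "sa T" for T
    by (simp add: norm_sq_cinner saD[OF that, of "app T x"])
  have sa: "sa (A - B)" using A B by (simp add: contrD)
  have "(norm (app X x))\<^sup>2 = (norm (app (A - B) x))\<^sup>2"
    by (simp only: norm_sa[OF pos_sa[OF X(1)]] norm_sa[OF sa] X(2))
  then have "norm (app X x) = norm (app (A - B) x)"
    by (rule power2_eq_imp_eq) (rule norm_ge_zero)+
  then have "norm (app A (x - app B x)) = norm (x - app B x)" using x by (simp add: X_def modulus_def)
  from contr_norm_eq[OF A this] show ?thesis using x by simp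
qed

lemma ac_supp_commute:
  assumes "contr A" "contr B" "ac A B"
  shows "supp A * B = B * supp A"
  using ac_eigenspace_invariant[OF assms]
  by (intro isproj_commute_fix isproj_supp) (simp_all add: supp_fix contrD assms)

lemma ac_null_commute:
  assumes "contr A" "contr B" "ac A B"
  shows "null A * B = B * null A"
  unfolding null_supp using assms by (intro ac_supp_commute contr_compl ac_compl)

section \<open>Localisation along commuting projections\<close>

lemma compress_mult:
  assumes "isproj P" "C * P = P * C"
  shows "(P * C) * (P * D) = P * (C * D)"
  by (metis assms(2) isprojD(2)[OF assms(1)] mult.assoc)

lemma modulus_commute_projection:
  assumes "A * P = P * A" "B * P = P * B"
  shows "modulus A B * P = P * modulus A B"
  by (simp add: modulus_def left_diff_distrib right_diff_distrib distrib_left distrib_right mult.assoc assms)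
    (simp add: assms flip: mult.assoc)

lemma modulus_compress:
  assumes "isproj P" "A * P = P * A" "B * P = P * B"
  shows "modulus (P * A) (P * B) = P * modulus A B"
  unfolding modulus_def compress_mult[OF assms(1,2)] compress_mult[OF assms(1,3)]
  by (simp add: algebra_simps)

lemma ac_compress:
  assumes P: "isproj P" and PA: "A * P = P * A" and PB: "B * P = P * B" and "ac A B"
  shows "ac (P * A) (P * B)"
proof -
  define X where "X = modulus A B"
  have X: "pos X" "pos (1 - X)" "X * X = (A - B) * (A - B)"
    using assms(4) by (simp_all add: ac_def X_def)
  have XP: "X * P = P * X" unfolding X_def by (rule modulus_commute_projection[OF PA PB])
  have "pos (P * X)"
    by (rule pos_commuting_projection[OF X(1) isprojD(1,2)[OF P] XP[symmetric]])
  moreover have "pos (P * (1 - X))"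
    by (rule pos_commuting_projection[OF X(2) isprojD(1,2)[OF P]]) (simp add: algebra_simps XP)
  \<comment> \<open>The upper bound in \<open>ac\<close> is the unit of the whole algebra, not P, so
    the complement 1 - P is added to the corner.\<close>
  then have "pos ((1 - P) + P * (1 - X))" by (rule pos_add[OF isproj_pos[OF isproj_compl[OF P]]])
  then have "pos (1 - P * X)" by (simp add: algebra_simps)
  moreover have "(P * X) * (P * X) = P * (A - B) * (P * (A - B))"
    unfolding compress_mult[OF P XP] X(3)
    by (rule compress_mult[OF P, symmetric]) (simp add: algebra_simps PA PB)
  ultimately show ?thesis
    by (simp add: ac_def modulus_compress[OF P PA PB] X_def right_diff_distrib[of P A B])
qed

lemma contr_compress:
  assumes "isproj P" "contr B" "B * P = P * B"
  shows "pos (P * B)" "pos (P - P * B)" "contr (P * B)"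
proof -
  show 1: "pos (P * B)"
    by (rule pos_commuting_projection[OF contrD(1)[OF assms(2)] isprojD(1,2)[OF assms(1)] assms(3)[symmetric]])
  have "pos (P * (1 - B))"
    by (rule pos_commuting_projection[OF contrD(2)[OF assms(2)] isprojD(1,2)[OF assms(1)]])
      (simp add: algebra_simps assms(3))
  then show 2: "pos (P - P * B)" by (simp add: algebra_simps)
  have "pos ((1 - P) + (P - P * B))" by (rule pos_add[OF isproj_pos[OF isproj_compl[OF assms(1)]] 2])
  then show "contr (P * B)" using 1 by (simp add: contr_def)
qed

text \<open>The modulus is (1 - P) B + P (1 - B) and its complement is (1 - P) (1 - B) + P B, sums
  of products of commuting positive elements; the squares agree because P is idempotent.\<close>

lemma ac_commuting_projection:
  assumes P: "isproj P" and B: "contr B" and PB: "B * P = P * B"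
  shows "ac P B"
proof -
  have PP: "P * (P * C) = P * C" and BP: "B * (P * C) = P * (B * C)" for C
    using isprojD(2)[OF P] PB by (metis mult.assoc)+
  have PB': "B * (1 - P) = (1 - P) * B" "(1 - B) * P = P * (1 - B)" "(1 - B) * (1 - P) = (1 - P) * (1 - B)"
    using PB by (simp_all add: algebra_simps)
  note pc = contr_compress(1)[OF _ _ PB'(1)] contr_compress(1)[OF _ _ PB'(2)]
    contr_compress(1)[OF _ _ PB'(3)] contr_compress(1)[OF P B PB]
  have "pos ((1 - P) * B + P * (1 - B))" "pos ((1 - P) * (1 - B) + P * B)"
    by (intro pos_add pc isproj_compl contr_compl P B)+
  then show ?thesis
    unfolding ac_def modulus_def by (simp add: algebra_simps PP BP PB isprojD(2)[OF P])
qed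

text \<open>On the kernel of P the form of X is squeezed between 0 and 0, so X vanishes
  there.\<close>

lemma projection_corner:
  assumes P: "isproj P" and X: "pos X" "pos (P - X)"
  shows "P * X = X" "X * P = X"
proof -
  have "X * (1 - P) = 0"
  proof (rule bop_eqI)
    fix x
    define y where "y = app (1 - P) x"
    have "app P y = 0" using isprojD(3)[OF P] by (simp add: y_def)
    then have "Re (cinner (app X y) y) \<le> 0"
      using posD[OF X(2), of y] by (simp add: cinner_simps)
    then have "app X y = 0" using pos_null[OF X(1)] posD[OF X(1), of y] by fastforce
    then show "app (X * (1 - P)) x = app 0 x" by (simp only: y_def app_simps)
  qed
  then show 1: "X * P = X" by (simp add: right_diff_distrib)
  show "P * X = X" by (rule sa_times_eqI[OF pos_sa[OF X(1)] isprojD(1)[OF P] pos_sa[OF X(1)] 1])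
qed

lemma contr_le_projection:
  assumes "isproj P" "pos X" "pos (P - X)"
  shows "contr X"
proof -
  have "pos ((1 - P) + (P - X))" by (rule pos_add[OF isproj_pos[OF isproj_compl[OF assms(1)]] assms(3)])
  then show ?thesis using assms(2) by (simp add: contr_def)
qed

lemma ac_le_projection:
  assumes "isproj P" "pos X" "pos (P - X)"
  shows "ac P X"
  using assms projection_corner[OF assms]
  by (intro ac_commuting_projection contr_le_projection) simp_all

lemma ac_zero: "contr X \<Longrightarrow> ac 0 X"
  by (rule ac_commuting_projection) (simp_all add: isproj_def)

lemma pos_sum_list: "(\<And>A. A \<in> set As \<Longrightarrow> pos A) \<Longrightarrow> pos (sum_list As)"
  by (induction As) auto

text \<open>Every C is the sum of the P * C, so positivity and the equation of squares may be tested
  after multiplication by each P.\<close>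

lemma ac_sum_list:
  assumes one: "sum_list Ps = 1"
    and P: "\<And>P. P \<in> set Ps \<Longrightarrow> isproj P"
    and PA: "\<And>P. P \<in> set Ps \<Longrightarrow> A * P = P * A" and PB: "\<And>P. P \<in> set Ps \<Longrightarrow> B * P = P * B"
    and ac: "\<And>P. P \<in> set Ps \<Longrightarrow> ac (P * A) (P * B)"
  shows "ac A B"
proof -
  define X where "X = modulus A B"
  have split: "C = sum_list (map (\<lambda>P. P * C) Ps)" for C
    using sum_list_mult_const[of "\<lambda>P. P" C Ps] one by simp
  have loc: "pos (P * X)" "pos (P * (1 - X))" "P * (X * X) = P * ((A - B) * (A - B))"
    if "P \<in> set Ps" for P
  proof -
    note p = P[OF that] and pa = PA[OF that] and pb = PB[OF that]
    have XP: "X * P = P * X" unfolding X_def by (rule modulus_commute_projection[OF pa pb])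
    have PX: "pos (P * X)" "pos (1 - P * X)"
      "(P * X) * (P * X) = (P * A - P * B) * (P * A - P * B)"
      using ac[OF that] by (simp_all add: ac_def modulus_compress[OF p pa pb] X_def)
    show "pos (P * X)" by (rule PX(1))
    have PPX: "P * (P * X) = P * X" using isprojD(2)[OF p] by (simp flip: mult.assoc)
    \<comment> \<open>The local hypothesis bounds P X by 1 instead of P; another compression by P
      removes the summand 1 - P.\<close>
    have "pos (P * (1 - P * X))"
      by (rule pos_commuting_projection[OF PX(2) isprojD(1,2)[OF p]])
        (simp add: right_diff_distrib left_diff_distrib mult.assoc XP PPX)
    then show "pos (P * (1 - X))" by (simp add: right_diff_distrib PPX)
    have "P * ((A - B) * (A - B)) = (P * (A - B)) * (P * (A - B))"
      by (rule compress_mult[OF p, symmetric]) (simp add: left_diff_distrib right_diff_distrib pa pb)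
    also have "\<dots> = P * (X * X)" using PX(3) compress_mult[OF p XP, of X] by (simp add: right_diff_distrib)
    finally show "P * (X * X) = P * ((A - B) * (A - B))" ..
  qed
  have "pos X" "pos (1 - X)"
    by (subst split, rule pos_sum_list, use loc in auto)+
  moreover have "X * X = (A - B) * (A - B)"
    by (subst split, subst (2) split) (use loc(3) in \<open>auto intro!: arg_cong[of _ _ sum_list] map_cong\<close>)
  ultimately show ?thesis by (simp add: ac_def X_def)
qed

section \<open>Von Neumann algebras\<close>

text \<open>The bicommutant condition turns membership into a commutation statement, so that closure
  under range projections becomes \<open>rp_commute\<close>.\<close>

lemma von_neumann_algebra_mem_iff:
  assumes "von_neumann_algebra M"
  shows "app A \<in> M \<longleftrightarrow> (\<forall>Y. app Y \<in> commutant M \<longrightarrow> Y * A = A * Y)"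
proof -
  have M: "M = commutant (commutant M)" using assms by (simp add: von_neumann_algebra_def)
  have "app A \<in> commutant (commutant M) \<longleftrightarrow> (\<forall>y\<in>commutant M. y \<circ> app A = app A \<circ> y)"
    by (subst commutant_def) simp
  also have "\<dots> \<longleftrightarrow> (\<forall>Y. app Y \<in> commutant M \<longrightarrow> app Y \<circ> app A = app A \<circ> app Y)"
  proof (intro iffI ballI)
    fix y assume h: "\<forall>Y. app Y \<in> commutant M \<longrightarrow> app Y \<circ> app A = app A \<circ> app Y" and y: "y \<in> commutant M"
    then have "bounded_op y" by (simp add: commutant_def)
    then obtain Y where "y = app Y" by (rule bounded_opE)
    then show "y \<circ> app A = app A \<circ> y" using h y by simp
  qed blast
  finally show ?thesis using M by (simp add: app_op_simps)
qed

lemma von_neumann_algebra_closed: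
  assumes M: "von_neumann_algebra M"
  shows "app 1 \<in> M" "app A \<in> M \<Longrightarrow> app B \<in> M \<Longrightarrow> app (A - B) \<in> M"
    "app A \<in> M \<Longrightarrow> app B \<in> M \<Longrightarrow> app (A * B) \<in> M"
    "sa T \<Longrightarrow> app T \<in> M \<Longrightarrow> app (rp T) \<in> M"
proof -
  note iff = von_neumann_algebra_mem_iff[OF M]
  show "app 1 \<in> M" by (simp add: iff)
  show "app A \<in> M \<Longrightarrow> app B \<in> M \<Longrightarrow> app (A - B) \<in> M" by (simp add: iff algebra_simps)
  show "app A \<in> M \<Longrightarrow> app B \<in> M \<Longrightarrow> app (A * B) \<in> M" unfolding iff by (metis mult.assoc)
  show "sa T \<Longrightarrow> app T \<in> M \<Longrightarrow> app (rp T) \<in> M" unfolding iff using rp_commute by metis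
qed

lemma von_neumann_algebra_supp:
  assumes "von_neumann_algebra M" "sa C" "app C \<in> M"
  shows "app (supp C) \<in> M" "app (null C) \<in> M"
  unfolding supp_def null_def using assms
  by (auto intro!: von_neumann_algebra_closed)

section \<open>The decomposition\<close>

lemma mutually_orthogonal_projections_5:
  "mutually_orthogonal_projections [app P, app Q, app R, app S, app T] \<longleftrightarrow>
    (isproj P \<and> isproj Q \<and> isproj R \<and> isproj S \<and> isproj T) \<and>
    (P * Q = 0 \<and> P * R = 0 \<and> P * S = 0 \<and> P * T = 0) \<and>
    (Q * P = 0 \<and> Q * R = 0 \<and> Q * S = 0 \<and> Q * T = 0) \<and>
    (R * P = 0 \<and> R * Q = 0 \<and> R * S = 0 \<and> R * T = 0) \<and>
    (S * P = 0 \<and> S * Q = 0 \<and> S * R = 0 \<and> S * T = 0) \<and>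
    (T * P = 0 \<and> T * Q = 0 \<and> T * R = 0 \<and> T * S = 0)"
  unfolding mutually_orthogonal_projections_def
  by (simp add: All_less_Suc2 is_projection_app app_op_simps)


text \<open>All five projections are combinations of S, N, S2 and N2, whose products are known, so
  most relations follow by expansion. Each orthogonality is listed in one order; the other order is
  its adjoint.\<close>

lemma ac_decomposition:
  fixes A B :: "'h::chilbert_space bop"
  assumes A: "contr A" and B: "contr B" and ac: "ac A B"
  defines "B2 \<equiv> (1 - supp A - null A) * B"
  defines "N1 \<equiv> 1 - supp A - null A - supp B2 - rp (ast B2)"
  shows "contr B2" "isproj N1" "supp A * B = B * supp A" "null A * B = B * null A"
    "A * supp B2 = supp B2 * A" "A * rp (ast B2) = rp (ast B2) * A" "A * N1 = N1 * A"
    "B * rp (ast B2) = rp (ast B2) * B" "ast B2 = rp (ast B2) * B"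
    "supp A * supp B2 = 0" "supp A * rp (ast B2) = 0" "supp A * N1 = 0" "supp A * null A = 0"
    "supp B2 * rp (ast B2) = 0" "supp B2 * N1 = 0" "supp B2 * null A = 0"
    "rp (ast B2) * N1 = 0" "rp (ast B2) * null A = 0" "N1 * null A = 0"
    "A = supp A + supp B2 * A + rp (ast B2) * A + N1 * A"
    "B = supp A * B + supp B2 + ast B2 + null A * B"
proof -
  define S where "S = supp A"
  define N where "N = null A"
  define Q where "Q = 1 - S - N"
  define S2 where "S2 = supp B2"
  define N2 where "N2 = null B2"
  define R where "R = rp (ast B2)"
  have saA: "sa A" and saB: "sa B" using A B by (simp_all add: contrD)
  have B2: "B2 = Q * B" by (simp add: B2_def Q_def S_def N_def)
  have pS: "isproj S" and pN: "isproj N" and pS2: "isproj S2" and pN2: "isproj N2" and pR: "isproj R"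
    by (simp_all add: S_def N_def S2_def N2_def R_def isproj_supp isproj_null rp_properties)
  have AS: "A * S = S" "S * A = S" and AN: "A * N = 0" "N * A = 0"
    and SN: "S * N = 0" "N * S = 0"
    using saA by (simp_all add: S_def N_def supp_mult null_mult supp_null_orthogonal)
  have BS: "S * B = B * S" unfolding S_def by (rule ac_supp_commute[OF A B ac])
  have BN: "N * B = B * N" unfolding N_def by (rule ac_null_commute[OF A B ac])
  have pQ: "isproj Q"
    using isprojD[OF pS] isprojD[OF pN] SN by (simp add: isproj_def Q_def algebra_simps)
  have QA: "Q * A = A * Q" by (simp add: Q_def algebra_simps AS AN)
  have QB: "B * Q = Q * B" by (simp add: Q_def algebra_simps BS BN)
  have cB2: "contr B2" unfolding B2 by (rule contr_compress[OF pQ B QB])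
  then have saB2: "sa B2" by (rule contrD)
  have QS: "Q * S = 0" and QN: "Q * N = 0"
    using isprojD(2)[OF pS] isprojD(2)[OF pN] SN by (simp_all add: Q_def algebra_simps)
  have B2S: "B2 * S = 0" "B2 * N = 0"
    by (simp_all add: B2 QS QN mult.assoc flip: BS BN) (simp_all add: QS QN flip: mult.assoc)
  \<comment> \<open>A vector fixed by B2 = Q B lies in the range of Q and is therefore fixed by B;
    now the eigenspace argument applies with A and B exchanged.\<close>
  have S2A: "S2 * A = A * S2"
  proof (rule isproj_commute_fix[OF pS2 saA])
    fix y assume "app S2 y = y"
    then have y: "app B2 y = y" by (simp add: S2_def supp_fix[OF saB2])
    have "Q * B2 = B2" using isprojD(2)[OF pQ] by (simp add: B2 flip: mult.assoc)
    then have Qy: "app Q y = y" using y by (metis app_simps(6))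
    have "app B (app Q y) = y" using y by (simp add: B2 flip: app_simps(6) QB)
    then have "app B y = y" by (simp only: Qy)
    from ac_eigenspace_invariant[OF B A ac_commute[OF ac] this]
    have BAy: "app B (app A y) = app A y" .
    have "app B2 (app A y) = app Q (app A y)" by (simp add: B2 BAy)
    also have "\<dots> = app A (app Q y)" by (simp add: QA flip: app_simps(6))
    finally show "app S2 (app A y) = app A y" by (simp add: S2_def supp_fix[OF saB2] Qy)
  qed
  \<comment> \<open>For y in the kernel of B2 it is Q y, not y itself, that B annihilates. The
    eigenspace argument is applied to 1 - B at Q y, and A commutes with Q.\<close>
  have N2A: "N2 * A = A * N2"
  proof (rule isproj_commute_fix[OF pN2 saA])
    fix y assume "app N2 y = y"
    then have "app B2 y = 0" by (simp only: N2_def null_fix[OF saB2])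
    then have "app B (app Q y) = 0" by (simp only: B2 QB[symmetric] app_simps(6))
    then have "app (1 - B) (app Q y) = app Q y" by simp
    from ac_eigenspace_invariant[OF contr_compl[OF B] A ac_compl[OF ac_commute[OF ac]] this]
    have BAQ: "app B (app A (app Q y)) = 0" by simp
    have "B2 * A = B * A * Q" by (simp add: B2 QA mult.assoc flip: QB)
    then have "app (B2 * A) y = app (B * A * Q) y" by (simp only:)
    then have "app B2 (app A y) = app B (app A (app Q y))" by (simp only: app_simps)
    then show "app N2 (app A y) = app A y" by (simp add: N2_def null_fix[OF saB2] BAQ)
  qed
  have R: "R = 1 - S2 - N2" by (simp add: R_def S2_def N2_def rp_ast[OF saB2])
  \<comment> \<open>The remaining block is the part of the kernel of B2 orthogonal to s(a) and
    n(a).\<close>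
  have N1: "N1 = N2 - S - N"
    by (simp add: N1_def R_def[symmetric] S2_def[symmetric] S_def[symmetric] N_def[symmetric] R)
  \<comment> \<open>B2 vanishes on the range of P, so P lies below the kernel projection N2.\<close>
  have absorb: "N2 * P = P" "P * N2 = P" if "isproj P" "B2 * P = 0" for P
  proof -
    show 1: "N2 * P = P"
    proof (rule bop_eqI)
      fix x
      have "app B2 (app P x) = 0" using that(2) by (simp flip: app_simps(6))
      then show "app (N2 * P) x = app P x" by (simp add: N2_def null_fix[OF saB2])
    qed
    show "P * N2 = P" using sa_times_eqI[OF _ _ _ 1] that(1) pN2 by (simp add: isprojD)
  qed
  note N2S = absorb[OF pS B2S(1)] and N2N = absorb[OF pN B2S(2)]
  have S2B2: "S2 * B2 = S2" "B2 * S2 = S2" "N2 * B2 = 0" "S2 * N2 = 0" "N2 * S2 = 0"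
    using saB2 by (simp_all add: S2_def N2_def supp_mult null_mult supp_null_orthogonal)
  have S2P: "S2 * P = 0" "P * S2 = 0" if "isproj P" "B2 * P = 0" for P
  proof -
    have "S2 * P = S2 * B2 * P" by (simp only: S2B2)
    then show 1: "S2 * P = 0" by (simp add: mult.assoc that(2))
    show "P * S2 = 0" using sa_times_eqI[OF _ _ _ 1] that(1) pS2 by (simp add: isprojD)
  qed
  note S2S = S2P[OF pS B2S(1)] and S2N = S2P[OF pN B2S(2)]
  note prods = AS AN SN N2S N2N S2B2 S2S S2N isprojD(2)[OF pS] isprojD(2)[OF pN]
    isprojD(2)[OF pS2] isprojD(2)[OF pN2]
  \<comment> \<open>R lies below Q, hence R B = R B2 = e(B2). This product is self-adjoint, which
    makes R and B commute.\<close>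
  have "R * Q = R" by (simp add: R Q_def algebra_simps prods)
  then have RB: "R * B = R * B2" by (simp add: B2 flip: mult.assoc)
  also have "\<dots> = B2 - S2" by (simp add: R algebra_simps prods)
  finally have RB: "R * B = ast B2" by (simp add: ast_def S2_def)
  have "sa (ast B2)" using saB2 isprojD(1)[OF pS2] by (simp add: ast_def S2_def)
  from sa_times_eqI[OF isprojD(1)[OF pR] saB this RB] have BR: "B * R = R * B" by (simp add: RB)
  note fold = S_def[symmetric] N_def[symmetric] S2_def[symmetric] R_def[symmetric]
  show "contr B2" by (rule cB2)
  show "isproj N1"
    using isprojD(1)[OF pS] isprojD(1)[OF pN] isprojD(1)[OF pN2]
    by (simp add: isproj_def N1 algebra_simps prods)
  show "supp A * B = B * supp A" "null A * B = B * null A" "A * supp B2 = supp B2 * A"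
    "A * rp (ast B2) = rp (ast B2) * A" "A * N1 = N1 * A"
    "B * rp (ast B2) = rp (ast B2) * B" "ast B2 = rp (ast B2) * B"
    unfolding fold using BS BN BR S2A N2A by (simp_all add: RB) (simp_all add: R N1 algebra_simps prods)
  show "supp A * supp B2 = 0" "supp A * rp (ast B2) = 0" "supp A * N1 = 0" "supp A * null A = 0"
    "supp B2 * rp (ast B2) = 0" "supp B2 * N1 = 0" "supp B2 * null A = 0"
    "rp (ast B2) * N1 = 0" "rp (ast B2) * null A = 0" "N1 * null A = 0"
    unfolding fold by (simp_all add: R N1 algebra_simps prods)
  show "A = supp A + supp B2 * A + rp (ast B2) * A + N1 * A"
    unfolding fold by (simp add: R N1 algebra_simps prods)
  have "S2 + ast B2 = Q * B" by (simp add: ast_def S2_def B2)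
  then show "B = supp A * B + supp B2 + ast B2 + null A * B"
    unfolding fold by (simp add: Q_def algebra_simps)
qed

text \<open>The blocks of the two sums are the pairs (S, B1), (A1, S2), (A2, E), (A3, 0) and (0,
  B3). Only the third needs a hypothesis; each of the others contains a projection dominating its
  partner, or 0.\<close>

lemma ac_of_decomposition:
  fixes S S2 R N1 N :: "'h::chilbert_space bop"
  assumes proj: "isproj S" "isproj S2" "isproj R" "isproj N1" "isproj N"
    and orth: "S * S2 = 0" "S * R = 0" "S * N1 = 0" "S * N = 0"
      "S2 * S = 0" "S2 * R = 0" "S2 * N1 = 0" "S2 * N = 0"
      "R * S = 0" "R * S2 = 0" "R * N1 = 0" "R * N = 0"
      "N1 * S = 0" "N1 * S2 = 0" "N1 * R = 0" "N1 * N = 0"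
      "N * S = 0" "N * S2 = 0" "N * R = 0" "N * N1 = 0"
    and one: "S + S2 + R + N1 + N = 1"
    and pos: "pos B1" "pos (S - B1)" "pos A1" "pos (S2 - A1)" "pos A2" "pos (R - A2)"
      "pos E" "pos (R - E)" "pos A3" "pos (N1 - A3)" "pos B3" "pos (N - B3)"
    and "ac A2 E"
  shows "ac (S + A1 + A2 + A3) (B1 + S2 + E + B3)"
proof -
  \<comment> \<open>X lives in the corner of P', so a projection P orthogonal to P' kills it from
    both sides.\<close>
  have ortho: "P * X = 0" "X * P = 0" if "P * P' = 0" "P' * P = 0" "P' * X = X" "X * P' = X" for P P' X :: "'h bop"
    using that by (metis mult.assoc mult_zero_left, metis mult.assoc mult_zero_right)
  note corner = projection_corner[OF proj(1) pos(1,2)] projection_corner[OF proj(2) pos(3,4)]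
    projection_corner[OF proj(3) pos(5,6)] projection_corner[OF proj(3) pos(7,8)]
    projection_corner[OF proj(4) pos(9,10)] projection_corner[OF proj(5) pos(11,12)]
  note zeros = ortho[OF _ _ corner(1,2)] ortho[OF _ _ corner(3,4)] ortho[OF _ _ corner(5,6)]
    ortho[OF _ _ corner(7,8)] ortho[OF _ _ corner(9,10)] ortho[OF _ _ corner(11,12)]
  show ?thesis
  proof (rule ac_sum_list[of "[S, S2, R, N1, N]"])
    show "sum_list [S, S2, R, N1, N] = 1" using one by (simp add: add.assoc)
    note rules = distrib_left distrib_right zeros corner orth isprojD(2)[OF proj(1)] isprojD(2)[OF proj(2)]
    have acs: "ac S B1" "ac A1 S2" "ac A3 0" "ac 0 B3"
      using proj pos by (auto intro: ac_le_projection ac_commute ac_zero contr_le_projection)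
    fix P assume "P \<in> set [S, S2, R, N1, N]"
    then have P: "P = S \<or> P = S2 \<or> P = R \<or> P = N1 \<or> P = N" by simp
    then show "isproj P" using proj by blast
    show "(S + A1 + A2 + A3) * P = P * (S + A1 + A2 + A3)"
      using P by (elim disjE) (simp_all add: rules)
    show "(B1 + S2 + E + B3) * P = P * (B1 + S2 + E + B3)"
      using P by (elim disjE) (simp_all add: rules)
    show "ac (P * (S + A1 + A2 + A3)) (P * (B1 + S2 + E + B3))"
      using P acs \<open>ac A2 E\<close> by (elim disjE) (simp_all add: rules)
  qed
qed

theorem theorem2p11:
  fixes M :: "('h::chilbert_space \<Rightarrow> 'h) set" and a b :: "'h \<Rightarrow> 'h"
  assumes "von_neumann_algebra M"
    and "a \<in> M" and "b \<in> M"
    and "op_le op_zero a" and "op_le a id"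
    and "op_le op_zero b" and "op_le b id"
  shows "abs_compatible a b \<longleftrightarrow>
    (\<exists>b2\<in>M. op_le op_zero b2 \<and> op_le b2 id \<and>
      (let n1 = op_sub (op_sub (op_sub (op_sub id (supp_proj a)) (null_proj a))
                  (supp_proj b2)) (range_proj (ast_part b2))
       in mutually_orthogonal_projections
            [supp_proj a, supp_proj b2, range_proj (ast_part b2), n1, null_proj a]
        \<and> op_add (op_add (op_add (op_add (supp_proj a) (supp_proj b2))
             (range_proj (ast_part b2))) n1) (null_proj a) = id
        \<and> (\<exists>b1\<in>M. \<exists>a1\<in>M. \<exists>a2\<in>M. \<exists>a3\<in>M. \<exists>b3\<in>M.
             op_le op_zero b1 \<and> op_le b1 (supp_proj a)
           \<and> op_le op_zero a1 \<and> op_le a1 (supp_proj b2)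
           \<and> op_le op_zero a2 \<and> op_le a2 (range_proj (ast_part b2))
           \<and> op_le op_zero (ast_part b2) \<and> op_le (ast_part b2) (range_proj (ast_part b2))
           \<and> op_le op_zero a3 \<and> op_le a3 n1
           \<and> op_le op_zero b3 \<and> op_le b3 (null_proj a)
           \<and> abs_compatible a2 (ast_part b2)
           \<and> a = op_add (op_add (op_add (supp_proj a) a1) a2) a3
           \<and> b = op_add (op_add (op_add b1 (supp_proj b2)) (ast_part b2)) b3)))"
  (is "_ \<longleftrightarrow> ?rhs")
proof -
  note M = assms(1)
  obtain A B where ab: "a = app A" "b = app B" using assms(4,6) by (metis bounded_opE op_le_def)
  have A: "contr A" and B: "contr B"
    using assms(4-7) by (simp_all add: ab contr_def app_op_simps op_le_app)
  have AM: "app A \<in> M" and BM: "app B \<in> M" using assms(2,3) by (simp_all add: ab)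
  have ac_iff: "abs_compatible a b \<longleftrightarrow> ac A B"
    unfolding ab by (rule abs_compatible_app) (simp_all add: A B contrD)
  have "?rhs" if ac: "ac A B"
  proof -
    define S where "S = supp A"
    define N where "N = null A"
    define B2 where "B2 = (1 - S - N) * B"
    define S2 where "S2 = supp B2"
    define E where "E = ast B2"
    define R where "R = rp E"
    define N1 where "N1 = 1 - S - N - S2 - R"
    note defs = S_def[symmetric] N_def[symmetric] B2_def[symmetric] S2_def[symmetric]
      E_def[symmetric] R_def[symmetric] N1_def[symmetric]
    note dec = ac_decomposition[OF A B ac, unfolded defs]
    have proj: "isproj S" "isproj S2" "isproj R" "isproj N1" "isproj N"
      using dec(2) by (simp_all add: S_def S2_def R_def N_def isproj_supp isproj_null rp_properties)
    \<comment> \<open>Supplies the reversed products by taking adjoints.\<close>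
    have orth: "Q * P = 0" if "P * Q = 0" "isproj P" "isproj Q" for P Q :: "'h bop"
      using sa_times_eqI[OF isprojD(1)[OF that(2)] isprojD(1)[OF that(3)] sa_0 that(1)] .
    have prods: "P * Q = 0 \<and> Q * P = 0"
      if "(P, Q) \<in> {(S, S2), (S, R), (S, N1), (S, N), (S2, R), (S2, N1), (S2, N), (R, N1), (R, N), (N1, N)}" for P Q
      using that dec(10-19) proj by (auto intro: orth)
    have mem: "app S \<in> M" "app N \<in> M" "app B2 \<in> M" "app S2 \<in> M" "app R \<in> M" "app N1 \<in> M"
    proof -
      note cl = von_neumann_algebra_closed[OF M] and sp = von_neumann_algebra_supp[OF M]
      show S: "app S \<in> M" and N: "app N \<in> M"
        unfolding S_def N_def using AM A by (auto intro!: sp contrD)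
      show B2: "app B2 \<in> M" unfolding B2_def by (intro cl S N BM)
      show S2: "app S2 \<in> M" unfolding S2_def using B2 dec(1) by (intro sp contrD)
      have "app E \<in> M" unfolding E_def ast_def S2_def[symmetric] by (intro cl B2 S2)
      moreover have "sa E"
        using contrD(3)[OF dec(1)] isprojD(1)[OF proj(2)] by (simp add: E_def ast_def S2_def)
      ultimately show R: "app R \<in> M" unfolding R_def by (intro cl)
      show "app N1 \<in> M" unfolding N1_def by (intro cl S N S2 R)
    qed
    have mem_mult: "app (S * B) \<in> M" "app (S2 * A) \<in> M" "app (R * A) \<in> M" "app (N1 * A) \<in> M" "app (N * B) \<in> M"
      by (intro von_neumann_algebra_closed(3)[OF M] mem AM BM)+
    note small = contr_compress(1,2)[OF proj(1) B dec(3)[symmetric]] contr_compress(1,2)[OF proj(2) A dec(5)]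
      contr_compress(1,2)[OF proj(3) A dec(6)] contr_compress(1,2)[OF proj(3) B dec(8), folded dec(9)]
      contr_compress(1,2)[OF proj(4) A dec(7)] contr_compress(1,2)[OF proj(5) B dec(4)[symmetric]]
    have sa: "sa (R * A)" "sa E" using small by (auto intro: pos_sa)
    \<comment> \<open>R A and E = R B are compressions of A and B by the same projection, which
      commutes with both.\<close>
    have acR: "abs_compatible (app (R * A)) (app E)"
      unfolding abs_compatible_app[OF sa] unfolding dec(9)
      by (rule ac_compress[OF proj(3) dec(6,8) ac])
    have one: "S + S2 + R + N1 + N = 1" by (simp add: N1_def)
    have ops: "supp_proj a = app S" "null_proj a = app N" "supp_proj (app B2) = app S2"
      "ast_part (app B2) = app E" "range_proj (app E) = app R"
      by (simp_all add: ab app_proj_simps S_def N_def S2_def E_def R_def)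
    have N1: "op_sub (op_sub (op_sub (op_sub id (app S)) (app N)) (app S2)) (app R) = app N1"
      by (simp add: app_op_simps N1_def)
    have mop: "mutually_orthogonal_projections [app S, app S2, app R, app N1, app N]"
      unfolding mutually_orthogonal_projections_5 using prods proj by blast
    have sum: "op_add (op_add (op_add (op_add (app S) (app S2)) (app R)) (app N1)) (app N) = id"
      by (simp add: app_op_simps one)
    have le: "pos X \<Longrightarrow> op_le op_zero (app X)" "pos (P - X) \<Longrightarrow> op_le (app X) (app P)" for X P :: "'h bop"
      by (simp_all add: app_op_simps op_le_app)
    have B2_le: "op_le op_zero (app B2)" "op_le (app B2) id"
      using dec(1) by (simp_all add: app_op_simps op_le_app contrD)
    have a_eq: "a = op_add (op_add (op_add (app S) (app (S2 * A))) (app (R * A))) (app (N1 * A))"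
      using dec(20) by (simp add: ab app_op_simps)
    have b_eq: "b = op_add (op_add (op_add (app (S * B)) (app S2)) (app E)) (app (N * B))"
      using dec(21) by (simp add: ab app_op_simps)
    show ?rhs
      unfolding Let_def
      by (rule bexI[of _ "app B2", OF _ mem(3)], unfold ops N1, intro conjI B2_le mop sum,
          rule bexI[OF _ mem_mult(1)], rule bexI[OF _ mem_mult(2)], rule bexI[OF _ mem_mult(3)],
          rule bexI[OF _ mem_mult(4)], rule bexI[OF _ mem_mult(5)])
        (intro conjI le small acR a_eq b_eq)
  qed
  \<comment> \<open>Here s(a), s(b_2), r(e(b_2)), n_1(b_2) and n(a) enter as an orthogonal family
    with sum 1, and a and b through their block sums.\<close>
  moreover have "ac A B" if rhs: ?rhs
    using rhs unfolding Let_def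
  proof (elim bexE conjE)
    fix b2 b1 a1 a2 a3 b3
    define n1 where "n1 = op_sub (op_sub (op_sub (op_sub id (supp_proj a)) (null_proj a)) (supp_proj b2)) (range_proj (ast_part b2))"
    assume b2: "op_le op_zero b2"
      and mop: "mutually_orthogonal_projections [supp_proj a, supp_proj b2, range_proj (ast_part b2),
        op_sub (op_sub (op_sub (op_sub id (supp_proj a)) (null_proj a)) (supp_proj b2)) (range_proj (ast_part b2)), null_proj a]"
      and le: "op_le op_zero b1" "op_le b1 (supp_proj a)" "op_le op_zero a1" "op_le a1 (supp_proj b2)"
        "op_le op_zero a2" "op_le a2 (range_proj (ast_part b2))"
        "op_le op_zero (ast_part b2)" "op_le (ast_part b2) (range_proj (ast_part b2))"
        "op_le op_zero a3"
        "op_le a3 (op_sub (op_sub (op_sub (op_sub id (supp_proj a)) (null_proj a)) (supp_proj b2)) (range_proj (ast_part b2)))"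
        "op_le op_zero b3" "op_le b3 (null_proj a)"
      and ac2: "abs_compatible a2 (ast_part b2)"
      and a_eq: "a = op_add (op_add (op_add (supp_proj a) a1) a2) a3"
      and b_eq: "b = op_add (op_add (op_add b1 (supp_proj b2)) (ast_part b2)) b3"
    obtain B2 B1 A1 A2 A3 B3 where ops: "b2 = app B2" "b1 = app B1" "a1 = app A1" "a2 = app A2" "a3 = app A3" "b3 = app B3"
      using b2 le unfolding op_le_def by (metis bounded_opE)
    define N1 where "N1 = 1 - supp A - null A - supp B2 - rp (ast B2)"
    have n1: "n1 = app N1" by (simp add: n1_def ab ops app_proj_simps app_op_simps N1_def)
    note mop = mop[folded n1_def, unfolded n1] and le = le[folded n1_def, unfolded n1]
    note bop = ab ops app_proj_simps
    have pos: "pos B1" "pos (supp A - B1)" "pos A1" "pos (supp B2 - A1)" "pos A2" "pos (rp (ast B2) - A2)"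
      "pos (ast B2)" "pos (rp (ast B2) - ast B2)" "pos A3" "pos (N1 - A3)" "pos B3" "pos (null A - B3)"
      using le unfolding bop by (simp_all add: app_op_simps op_le_app)
    have one: "supp A + supp B2 + rp (ast B2) + N1 + null A = 1"
      by (simp add: N1_def)
    have ac2': "ac A2 (ast B2)"
      using ac2 abs_compatible_app[OF pos_sa[OF pos(5)] pos_sa[OF pos(7)]] unfolding bop by blast
    have A_eq: "A = supp A + A1 + A2 + A3" and B_eq: "B = B1 + supp B2 + ast B2 + B3"
      using a_eq b_eq unfolding bop by (simp_all add: app_op_simps)
    \<comment> \<open>The premises left open are the five projections and their twenty products in
      both orders, all contained in \<open>mop\<close>.\<close>
    have "ac (supp A + A1 + A2 + A3) (B1 + supp B2 + ast B2 + B3)"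
      using mop unfolding bop mutually_orthogonal_projections_5
      by (intro ac_of_decomposition[OF _ _ _ _ _ _ _ _ _ _ _ _ _ _ _ _ _ _ _ _ _ _ _ _ _ one pos ac2']) simp_all
    then show "ac A B" by (simp only: A_eq[symmetric] B_eq[symmetric])
  qed
  ultimately show ?thesis using ac_iff by blast
qed

end
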